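(* Let $X$ be one of the complex Banach spaces $l^p$, $1\le p<\infty$, or $c_0$ (sequences indexed by $n=1,2,\ldots$), let $\Delta\subset\mathbb C$ be the closed unit disc, and let $\alpha:\Delta\to X$ be given by $\alpha(\zeta)=(\zeta^{n!}/n^2)_{n=1}^\infty$. Let $\mathcal J\subset\mathcal O_X$ be the sheaf of germs of holomorphic functions on $X$ that vanish on $\alpha(\Delta)$. Then for no Banach space $F$ and analytic homomorphism $\mathcal O^F\to\mathcal J$ over $X$ is the restriction $\mathcal O^F_0\to\mathcal J_0$ to the stalks at $0\in X$ surjective.
   Context: All Banach spaces are over $\mathbb C$. For a Banach space $F$, $\mathcal O^F=\mathcal O_X^F$ is the sheaf of germs of $F$-valued holomorphic (complex Fréchet differentiable) functions on $X$, and $\mathcal O_X=\mathcal O^{\mathbb C}$. $F^*=\operatorname{Hom}(F,\mathbb C)$ is the Banach space of bounded linear functionals on $F$. An analytic homomorphism $\mathcal O^F\to\mathcal J$ is a homomorphism of $\mathcal O_X$-modules $\mathcal O^F\to\mathcal J\subset\mathcal O_X$ that is induced by a holomorphic function $\varphi:X\to F^*$, i.e. it is of the form $\mathbf f\mapsto\varphi\mathbf f$ (pointwise application of $\varphi(x)\in F^*$ to values in $F$), and takes values in $\mathcal J$. *)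

theory Defs
  imports "HOL-Analysis.Analysis"
begin

section \<open>Complex Banach spaces\<close>

class scaleC =
  fixes scaleC :: "complex \<Rightarrow> 'a \<Rightarrow> 'a" (infixr \<open>*\<^sub>C\<close> 75)

class complex_normed_vector = real_normed_vector + scaleC +
  assumes scaleC_add_right: "a *\<^sub>C (x + y) = a *\<^sub>C x + a *\<^sub>C y"
    and scaleC_add_left: "(a + b) *\<^sub>C x = a *\<^sub>C x + b *\<^sub>C x"
    and scaleC_scaleC: "a *\<^sub>C (b *\<^sub>C x) = (a * b) *\<^sub>C x"
    and scaleC_of_real: "complex_of_real r *\<^sub>C x = r *\<^sub>R x"
    and norm_scaleC: "norm (a *\<^sub>C x) = cmod a * norm x"

class complex_banach = complex_normed_vector + banach

instantiation complex :: complex_banach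
begin

definition scaleC_complex :: "complex \<Rightarrow> complex \<Rightarrow> complex"
  where "scaleC_complex a x = a * x"

instance
  by standard (auto simp: scaleC_complex_def algebra_simps scaleR_conv_of_real norm_mult)

end

lemma bounded_linear_scaleC: "bounded_linear (\<lambda>x :: 'a::complex_normed_vector. a *\<^sub>C x)"
proof (rule bounded_linear_intro[where K = "cmod a"])
  fix x y :: 'a and r :: real
  show "a *\<^sub>C (x + y) = a *\<^sub>C x + a *\<^sub>C y" by (rule scaleC_add_right)
  show "a *\<^sub>C (r *\<^sub>R x) = r *\<^sub>R (a *\<^sub>C x)"
    by (simp add: scaleC_scaleC mult.commute flip: scaleC_of_real)
  show "norm (a *\<^sub>C x) \<le> norm x * cmod a" by (simp add: norm_scaleC)
qed

instantiation blinfun :: (real_normed_vector, complex_normed_vector) complex_normed_vector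
begin

definition scaleC_blinfun :: "complex \<Rightarrow> 'a \<Rightarrow>\<^sub>L 'b \<Rightarrow> 'a \<Rightarrow>\<^sub>L 'b"
  where "scaleC_blinfun a T = Blinfun (\<lambda>x. a *\<^sub>C blinfun_apply T x)"

lemma blinfun_apply_scaleC:
  "blinfun_apply (a *\<^sub>C T) x = a *\<^sub>C blinfun_apply T x" for T :: "'a \<Rightarrow>\<^sub>L 'b"
  unfolding scaleC_blinfun_def
  by (subst bounded_linear_Blinfun_apply)
    (auto intro: bounded_linear_compose[OF bounded_linear_scaleC] blinfun.bounded_linear_right)

instance
proof
  fix a b :: complex and r :: real and S T :: "'a \<Rightarrow>\<^sub>L 'b"
  show "a *\<^sub>C (S + T) = a *\<^sub>C S + a *\<^sub>C T"
    by (rule blinfun_eqI) (simp add: blinfun_apply_scaleC blinfun.add_left scaleC_add_right)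
  show "(a + b) *\<^sub>C T = a *\<^sub>C T + b *\<^sub>C T"
    by (rule blinfun_eqI) (simp add: blinfun_apply_scaleC blinfun.add_left scaleC_add_left)
  show "a *\<^sub>C (b *\<^sub>C T) = (a * b) *\<^sub>C T"
    by (rule blinfun_eqI) (simp add: blinfun_apply_scaleC scaleC_scaleC)
  show "complex_of_real r *\<^sub>C T = r *\<^sub>R T"
    by (rule blinfun_eqI) (simp add: blinfun_apply_scaleC scaleC_of_real blinfun.scaleR_left)
  have le: "norm (c *\<^sub>C R) \<le> cmod c * norm R" for c and R :: "'a \<Rightarrow>\<^sub>L 'b"
  proof (rule norm_blinfun_bound)
    fix x
    have "cmod c * norm (blinfun_apply R x) \<le> cmod c * (norm R * norm x)"
      by (intro mult_left_mono norm_blinfun norm_ge_zero)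
    then show "norm (blinfun_apply (c *\<^sub>C R) x) \<le> cmod c * norm R * norm x"
      by (simp add: blinfun_apply_scaleC norm_scaleC mult.assoc)
  qed simp
  show "norm (a *\<^sub>C T) = cmod a * norm T"
  proof (cases "a = 0")
    case True
    then show ?thesis using le[of a T] by simp
  next
    case False
    have "inverse a *\<^sub>C (a *\<^sub>C T) = T"
      using False scaleC_of_real[of 1]
      by (intro blinfun_eqI) (simp add: blinfun_apply_scaleC scaleC_scaleC)
    then have "norm T \<le> inverse (cmod a) * norm (a *\<^sub>C T)"
      using le[of "inverse a" "a *\<^sub>C T"] by (simp add: norm_inverse)
    then have "cmod a * norm T \<le> norm (a *\<^sub>C T)"
      using False by (simp add: field_simps)
    then show ?thesis using le[of a T] by simp
  qed
qed

end

text \<open>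
  The type \<open>'f \<Rightarrow>\<^sub>L complex\<close> consists of the bounded real-linear functionals with the operator norm.
  The dual \<open>F\<^sup>*\<close> is its closed complex subspace of complex-linear functionals; a map is
  holomorphic into \<open>F\<^sup>*\<close> iff it is holomorphic into \<open>'f \<Rightarrow>\<^sub>L complex\<close> and has values in \<open>F\<^sup>*\<close>.
\<close>

definition dual_space :: "('f::complex_banach \<Rightarrow>\<^sub>L complex) set"
  where "dual_space = {T. \<forall>c v. blinfun_apply T (c *\<^sub>C v) = c * blinfun_apply T v}"


section \<open>The sequence spaces\<close>

text \<open>
  Since the exponent is a term, these spaces are subsets of \<open>nat \<Rightarrow> complex\<close> together with an
  explicit norm. The coordinate with index \<open>k\<close> is the \<open>n\<close>-th one for \<open>n = k + 1\<close>.
\<close>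

datatype seq_space = Lp real | C0

fun seqs :: "seq_space \<Rightarrow> (nat \<Rightarrow> complex) set" where
  "seqs (Lp p) = {x. summable (\<lambda>k. cmod (x k) powr p)}"
| "seqs C0 = {x. x \<longlonglongrightarrow> 0}"

fun seq_norm :: "seq_space \<Rightarrow> (nat \<Rightarrow> complex) \<Rightarrow> real" where
  "seq_norm (Lp p) x = (\<Sum>k. cmod (x k) powr p) powr (1 / p)"
| "seq_norm C0 x = (SUP k. cmod (x k))"

definition seq_open :: "seq_space \<Rightarrow> (nat \<Rightarrow> complex) set \<Rightarrow> bool" where
  "seq_open X U \<longleftrightarrow> U \<subseteq> seqs X \<and>
     (\<forall>x\<in>U. \<exists>e>0. \<forall>y\<in>seqs X. seq_norm X (\<lambda>k. y k - x k) < e \<longrightarrow> y \<in> U)"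

definition bounded_clinear_seq ::
    "seq_space \<Rightarrow> ((nat \<Rightarrow> complex) \<Rightarrow> 'b::complex_normed_vector) \<Rightarrow> bool" where
  "bounded_clinear_seq X D \<longleftrightarrow>
     (\<forall>h\<in>seqs X. \<forall>h'\<in>seqs X. D (\<lambda>k. h k + h' k) = D h + D h') \<and>
     (\<forall>c. \<forall>h\<in>seqs X. D (\<lambda>k. c * h k) = c *\<^sub>C D h) \<and>
     (\<exists>K. \<forall>h\<in>seqs X. norm (D h) \<le> K * seq_norm X h)"

definition has_frechet_derivative_seq ::
    "seq_space \<Rightarrow> ((nat \<Rightarrow> complex) \<Rightarrow> 'b::complex_normed_vector) \<Rightarrow>
     ((nat \<Rightarrow> complex) \<Rightarrow> 'b) \<Rightarrow> (nat \<Rightarrow> complex) \<Rightarrow> bool" where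
  "has_frechet_derivative_seq X f D x \<longleftrightarrow> bounded_clinear_seq X D \<and>
     (\<forall>e>0. \<exists>d>0. \<forall>h\<in>seqs X. seq_norm X h < d \<longrightarrow>
        norm (f (\<lambda>k. x k + h k) - f x - D h) \<le> e * seq_norm X h)"

text \<open>To be used for open \<open>U\<close>; the values of \<open>f\<close> outside \<open>U\<close> are then irrelevant.\<close>

definition holomorphic_seq ::
    "seq_space \<Rightarrow> (nat \<Rightarrow> complex) set \<Rightarrow>
     ((nat \<Rightarrow> complex) \<Rightarrow> 'b::complex_normed_vector) \<Rightarrow> bool" where
  "holomorphic_seq X U f \<longleftrightarrow> (\<forall>x\<in>U. \<exists>D. has_frechet_derivative_seq X f D x)"


section \<open>Sheaves of germs\<close>

definition germ ::
    "seq_space \<Rightarrow> (nat \<Rightarrow> complex) \<Rightarrow> ((nat \<Rightarrow> complex) \<Rightarrow> 'b) \<Rightarrow> ((nat \<Rightarrow> complex) \<Rightarrow> 'b) set" where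
  "germ X x f = {g. \<exists>U. seq_open X U \<and> x \<in> U \<and> (\<forall>y\<in>U. g y = f y)}"

definition O_stalk ::
    "seq_space \<Rightarrow> (nat \<Rightarrow> complex) \<Rightarrow> ((nat \<Rightarrow> complex) \<Rightarrow> 'b::complex_normed_vector) set set" where
  "O_stalk X x = {germ X x f | f. \<exists>U. seq_open X U \<and> x \<in> U \<and> holomorphic_seq X U f}"

definition vanishing_stalk ::
    "seq_space \<Rightarrow> (nat \<Rightarrow> complex) set \<Rightarrow> (nat \<Rightarrow> complex) \<Rightarrow> ((nat \<Rightarrow> complex) \<Rightarrow> complex) set set" where
  "vanishing_stalk X A x =
     {germ X x g | g. \<exists>U. seq_open X U \<and> x \<in> U \<and> holomorphic_seq X U g \<and> (\<forall>y\<in>U \<inter> A. g y = 0)}"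

definition stalk_map ::
    "seq_space \<Rightarrow> ((nat \<Rightarrow> complex) \<Rightarrow> ('f::complex_banach \<Rightarrow>\<^sub>L complex)) \<Rightarrow> (nat \<Rightarrow> complex) \<Rightarrow>
     ((nat \<Rightarrow> complex) \<Rightarrow> 'f) set \<Rightarrow> ((nat \<Rightarrow> complex) \<Rightarrow> complex) set" where
  "stalk_map X \<phi> x G = (\<Union>f\<in>G. germ X x (\<lambda>y. blinfun_apply (\<phi> y) (f y)))"

lemma seq_open_seqs: "seq_open X (seqs X)"
  by (auto simp: seq_open_def intro: exI[of _ 1])

lemma seq_open_Int:
  assumes "seq_open X U" "seq_open X V"
  shows "seq_open X (U \<inter> V)"
  unfolding seq_open_def
proof (intro conjI ballI)
  show "U \<inter> V \<subseteq> seqs X" using assms by (auto simp: seq_open_def)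
next
  fix x assume "x \<in> U \<inter> V"
  then obtain d e where "d > 0" "e > 0"
    "\<forall>y\<in>seqs X. seq_norm X (\<lambda>k. y k - x k) < d \<longrightarrow> y \<in> U"
    "\<forall>y\<in>seqs X. seq_norm X (\<lambda>k. y k - x k) < e \<longrightarrow> y \<in> V"
    using assms unfolding seq_open_def by blast
  then show "\<exists>e>0. \<forall>y\<in>seqs X. seq_norm X (\<lambda>k. y k - x k) < e \<longrightarrow> y \<in> U \<inter> V"
    by (intro exI[of _ "min d e"]) auto
qed

lemma germ_self: "x \<in> seqs X \<Longrightarrow> f \<in> germ X x f"
  using seq_open_seqs by (auto simp: germ_def)

lemma germ_cong:
  assumes "seq_open X U" "x \<in> U" "\<And>y. y \<in> U \<Longrightarrow> f y = g y"
  shows "germ X x f = germ X x g"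
proof -
  have "h \<in> germ X x v"
    if "h \<in> germ X x u" "\<And>y. y \<in> U \<Longrightarrow> u y = v y" for h u v
  proof -
    from that(1) obtain V where "seq_open X V" "x \<in> V" "\<forall>y\<in>V. h y = u y"
      by (auto simp: germ_def)
    then show ?thesis
      using that(2) assms(1,2) seq_open_Int[of X U V]
      by (auto simp: germ_def intro!: exI[of _ "U \<inter> V"])
  qed
  then show ?thesis using assms(3) by (metis subsetI subset_antisym)
qed

lemma stalk_map_germ:
  assumes "x \<in> seqs X"
  shows "stalk_map X \<phi> x (germ X x f) = germ X x (\<lambda>y. blinfun_apply (\<phi> y) (f y))"
proof -
  have "germ X x (\<lambda>y. blinfun_apply (\<phi> y) (g y)) = germ X x (\<lambda>y. blinfun_apply (\<phi> y) (f y))"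
    if "g \<in> germ X x f" for g
  proof -
    from that obtain U where "seq_open X U" "x \<in> U" "\<forall>y\<in>U. g y = f y"
      by (auto simp: germ_def)
    then show ?thesis by (intro germ_cong[of X U]) auto
  qed
  then show ?thesis
    unfolding stalk_map_def using germ_self[OF assms, of f] by blast
qed

text \<open>
  \<open>J x\<close> is the stalk at \<open>x\<close> of a subsheaf of the sheaf of germs of holomorphic functions.
  Linearity over that sheaf is automatic for maps of this form.
\<close>

definition analytic_hom ::
    "seq_space \<Rightarrow> ((nat \<Rightarrow> complex) \<Rightarrow> ((nat \<Rightarrow> complex) \<Rightarrow> complex) set set) \<Rightarrow>
     ((nat \<Rightarrow> complex) \<Rightarrow> ('f::complex_banach \<Rightarrow>\<^sub>L complex)) \<Rightarrow> bool" where
  "analytic_hom X J \<phi> \<longleftrightarrow>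
     holomorphic_seq X (seqs X) \<phi> \<and> (\<forall>x\<in>seqs X. \<phi> x \<in> dual_space) \<and>
     (\<forall>x\<in>seqs X. \<forall>G\<in>O_stalk X x. stalk_map X \<phi> x G \<in> J x)"

definition alpha :: "complex \<Rightarrow> nat \<Rightarrow> complex" where
  "alpha \<zeta> k = \<zeta> ^ fact (k + 1) / (of_nat (k + 1))\<^sup>2"

end

theory Submission
  imports Defs "HOL-Complex_Analysis.Complex_Analysis" "HOL-Real_Asymp.Real_Asymp"
begin

text \<open>
  Number coordinates from \<open>0\<close>, so that the curve has coordinates \<open>\<zeta> ^ (k + 1)! / (k + 1)\<^sup>2\<close>. The function
  \<open>g x = (\<Sum>k. c\<^sub>k (x\<^sub>k - x\<^sub>0 ^ (k + 1)! / (k + 1)\<^sup>2))\<close> with \<open>c\<^sub>k = (3/4) ^ k\<close> is holomorphic for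
  \<open>\<bar>x\<^sub>0\<bar> < 1\<close> and vanishes on the curve. If \<open>g = \<phi> f\<close> near \<open>0\<close>, put \<open>u x = \<phi> x (f 0)\<close>. This is an entire
  function on the whole space that vanishes on the curve, and its derivative at \<open>0\<close> has coordinates
  \<open>c\<^sub>n\<close> for \<open>n \<ge> 1\<close>. Such a function must have very small coordinates: cutting the curve after its
  first \<open>n\<close> coordinates and inserting it into \<open>u\<close> gives an entire function \<open>P\<close> of one variable with
  leading term \<open>- c\<^sub>n / (n + 1)\<^sup>2 * \<zeta> ^ (n + 1)!\<close>. For \<open>\<bar>\<zeta>\<bar> ^ n! = 2\<close> the cut curve stays in the compact
  box of radii \<open>2 / (k + 1)\<^sup>2\<close>, where \<open>u\<close> is bounded by some \<open>M\<close> independent of \<open>n\<close>. Hence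
  \<open>c\<^sub>n / (n + 1)\<^sup>2 \<le> M / 2 ^ (n + 1)\<close>, which fails for large \<open>n\<close>.

  Norms are estimated by domination with summable weights throughout, which avoids Minkowski's
  inequality.
\<close>

section \<open>Domination, chain rule and compact boxes in the sequence spaces\<close>

locale classical_seq_space =
  fixes X :: seq_space
  assumes X_cases: "(\<exists>p\<ge>1. X = Lp p) \<or> X = C0"
begin

text \<open>A coordinatewise bound yields both membership and a norm bound, with \<open>C\<close>
  depending on \<open>w\<close> alone. In \<open>Lp p\<close>, \<open>w\<close> is eventually below
  1, so \<open>w k powr p \<le> w k\<close> because \<open>p \<ge> 1\<close>, and the
  \<open>p\<close>-th powers are summable; in \<open>C0\<close> a bound for \<open>w\<close> serves
  as \<open>C\<close>.\<close>

lemma dominated_seq: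
  fixes w :: "nat \<Rightarrow> real"
  assumes "summable w" "\<And>k. 0 \<le> w k"
  obtains C where "C > 0"
    and "\<And>h B. 0 \<le> B \<Longrightarrow> (\<And>k. cmod (h k) \<le> B * w k) \<Longrightarrow> h \<in> seqs X \<and> seq_norm X h \<le> C * B"
proof -
  have w0: "w \<longlonglongrightarrow> 0" using assms(1) by (rule summable_LIMSEQ_zero)
  show thesis using X_cases
  proof
    assume "\<exists>p\<ge>1. X = Lp p"
    then obtain p where p: "p \<ge> 1" and X: "X = Lp p" by blast
    have "eventually (\<lambda>k. w k < 1) sequentially"
      using w0 by (rule order_tendstoD) simp
    then have "eventually (\<lambda>k. norm (w k powr p) \<le> w k) sequentially"
    proof eventually_elim
      case (elim k)
      then show ?case using powr_mono'[of 1 p "w k"] p assms(2)[of k] by simp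
    qed
    then have sw: "summable (\<lambda>k. w k powr p)"
      by (rule summable_comparison_test_ev) (rule assms(1))
    \<comment> \<open>The added 1 keeps \<open>C\<close> positive even if \<open>w\<close> is
      identically 0.\<close>
    define C where "C = (\<Sum>k. w k powr p) powr (1 / p) + 1"
    show thesis
    proof (rule that[of C])
      show "C > 0" unfolding C_def by (simp add: add_nonneg_pos)
      fix h :: "nat \<Rightarrow> complex" and B :: real
      assume B: "0 \<le> B" and h: "\<And>k. cmod (h k) \<le> B * w k"
      have le: "cmod (h k) powr p \<le> B powr p * w k powr p" for k
        using powr_mono2[of p "cmod (h k)" "B * w k"] h[of k] p B assms(2)[of k]
        by (simp add: powr_mult)
      have sB: "summable (\<lambda>k. B powr p * w k powr p)" using sw by (rule summable_mult)
      have sh: "summable (\<lambda>k. cmod (h k) powr p)"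
        by (rule summable_comparison_test'[OF sB, of 0]) (use le in auto)
      have "(\<Sum>k. cmod (h k) powr p) \<le> (\<Sum>k. B powr p * w k powr p)"
        by (rule suminf_le[OF le sh sB])
      also have "\<dots> = B powr p * (\<Sum>k. w k powr p)" by (rule suminf_mult[OF sw])
      finally have "(\<Sum>k. cmod (h k) powr p) powr (1/p)
          \<le> (B powr p * (\<Sum>k. w k powr p)) powr (1/p)"
        using p by (intro powr_mono2 suminf_nonneg sh) auto
      also have "\<dots> = B * (\<Sum>k. w k powr p) powr (1/p)"
        using p B by (simp add: powr_mult powr_powr suminf_nonneg sw)
      also have "\<dots> \<le> C * B" using B by (simp add: C_def algebra_simps)
      finally show "h \<in> seqs X \<and> seq_norm X h \<le> C * B" using sh by (simp add: X)
    qed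
  next
    assume X: "X = C0"
    from w0 have "Bseq w" by (intro convergent_imp_Bseq) (auto simp: convergent_def)
    then obtain C where C: "C > 0" "\<And>k. norm (w k) \<le> C" unfolding Bseq_def by blast
    show thesis
    proof (rule that[of C])
      show "C > 0" by fact
      fix h :: "nat \<Rightarrow> complex" and B :: real
      assume B: "0 \<le> B" and h: "\<And>k. cmod (h k) \<le> B * w k"
      have "h \<longlonglongrightarrow> 0"
        by (rule Lim_null_comparison[of _ "\<lambda>k. B * w k"])
          (use h tendsto_mult_right_zero[OF w0, of B] in auto)
      moreover have "(SUP k. cmod (h k)) \<le> C * B"
      proof (rule cSUP_least)
        fix k
        have "B * w k \<le> B * C" using C(2)[of k] B by (intro mult_left_mono) auto
        then show "cmod (h k) \<le> C * B" using h[of k] by (simp add: mult.commute)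
      qed simp
      ultimately show "h \<in> seqs X \<and> seq_norm X h \<le> C * B" by (simp add: X)
    qed
  qed
qed

lemma coordinate_le_seq_norm:
  assumes "h \<in> seqs X"
  shows "cmod (h k) \<le> seq_norm X h"
  using X_cases
proof
  assume "\<exists>p\<ge>1. X = Lp p"
  then obtain p where p: "p \<ge> 1" and X: "X = Lp p" by blast
  have s: "summable (\<lambda>k. cmod (h k) powr p)" using assms by (simp add: X)
  have "cmod (h k) powr p \<le> (\<Sum>k. cmod (h k) powr p)"
    using sum_le_suminf[OF s, of "{k}"] by simp
  then have "(cmod (h k) powr p) powr (1/p) \<le> (\<Sum>k. cmod (h k) powr p) powr (1/p)"
    using p by (intro powr_mono2) auto
  then show ?thesis using p by (simp add: X powr_powr)
next
  assume X: "X = C0"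
  then have "h \<longlonglongrightarrow> 0" using assms by simp
  then have "Bseq h" by (intro convergent_imp_Bseq) (auto simp: convergent_def)
  then obtain C where "\<And>k. norm (h k) \<le> C" unfolding Bseq_def by blast
  then have "bdd_above (range (\<lambda>k. cmod (h k)))" by (intro bdd_aboveI2)
  then show ?thesis using cSUP_upper[of k UNIV "\<lambda>k. cmod (h k)"] by (simp add: X)
qed

lemma seq_norm_nonneg: "h \<in> seqs X \<Longrightarrow> 0 \<le> seq_norm X h"
  using coordinate_le_seq_norm[of h 0] norm_ge_zero order_trans by blast

text \<open>The derivative estimate with error constant 1 is added to the operator bound of
  \<open>D\<close>; taking \<open>\<bar>K\<bar> + 1\<close> makes the constant positive whatever the
  sign of \<open>K\<close>.\<close>

lemma frechet_derivative_seq_lipschitz: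
  assumes "has_frechet_derivative_seq X f D x"
  obtains L d where "L > 0" "d > 0"
    "\<And>h. h \<in> seqs X \<Longrightarrow> seq_norm X h < d \<Longrightarrow> norm (f (\<lambda>k. x k + h k) - f x) \<le> L * seq_norm X h"
proof -
  obtain K where K: "\<And>h. h \<in> seqs X \<Longrightarrow> norm (D h) \<le> K * seq_norm X h"
    using assms unfolding has_frechet_derivative_seq_def bounded_clinear_seq_def by blast
  obtain d where d: "d > 0" "\<And>h. h \<in> seqs X \<Longrightarrow> seq_norm X h < d \<Longrightarrow>
        norm (f (\<lambda>k. x k + h k) - f x - D h) \<le> 1 * seq_norm X h"
    using assms unfolding has_frechet_derivative_seq_def by (metis zero_less_one)
  show thesis
  proof (rule that[of "\<bar>K\<bar> + 1" d])
    fix h assume h: "h \<in> seqs X" "seq_norm X h < d"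
    have "norm (f (\<lambda>k. x k + h k) - f x) \<le> norm (f (\<lambda>k. x k + h k) - f x - D h) + norm (D h)"
      using norm_triangle_ineq[of "f (\<lambda>k. x k + h k) - f x - D h" "D h"] by simp
    also have "\<dots> \<le> 1 * seq_norm X h + K * seq_norm X h"
      using d(2)[OF h] K[OF h(1)] by linarith
    also have "\<dots> \<le> (\<bar>K\<bar> + 1) * seq_norm X h"
      using seq_norm_nonneg[OF h(1)] by (simp add: algebra_simps mult_right_mono)
    finally show "norm (f (\<lambda>k. x k + h k) - f x) \<le> (\<bar>K\<bar> + 1) * seq_norm X h" .
  qed (use d in auto)
qed

text \<open>\<open>b\<close> is a curve with velocity \<open>b'\<close> whose first-order error is
  small relative to \<open>w\<close>, uniformly in the coordinates; \<open>dominated_seq\<close>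
  turns this into smallness in the norm. The increment splits as \<open>s * b'\<close> plus a
  remainder \<open>h2\<close>, and \<open>D h2\<close> is absorbed by the bound on
  \<open>D\<close>.\<close>

lemma has_frechet_derivative_seq_chain:
  fixes u :: "(nat \<Rightarrow> complex) \<Rightarrow> complex" and b :: "complex \<Rightarrow> nat \<Rightarrow> complex" and w :: "nat \<Rightarrow> real"
  assumes w: "summable w" "\<And>k. 0 \<le> w k"
    and D: "has_frechet_derivative_seq X u D (b z)"
    and B: "\<And>k. cmod (b' k) \<le> B * w k"
    and b: "\<And>e. e > 0 \<Longrightarrow> eventually (\<lambda>s. \<forall>k. cmod (b (z + s) k - b z k - s * b' k) \<le> e * cmod s * w k) (at 0)"
  shows "((\<lambda>z. u (b z)) has_field_derivative D b') (at z)"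
proof -
  obtain C where C: "C > 0"
    "\<And>h B. 0 \<le> B \<Longrightarrow> (\<And>k. cmod (h k) \<le> B * w k) \<Longrightarrow> h \<in> seqs X \<and> seq_norm X h \<le> C * B"
    using dominated_seq[OF w] by blast
  define B1 where "B1 = \<bar>B\<bar>"
  have B1: "cmod (b' k) \<le> B1 * w k" for k
    using B[of k] w(2)[of k] by (smt (verit) B1_def mult_right_mono)
  have B1_nn: "B1 \<ge> 0" by (simp add: B1_def)
  have b'X: "b' \<in> seqs X" using C(2)[OF B1_nn B1] by simp
  obtain K where K: "\<And>h. h \<in> seqs X \<Longrightarrow> norm (D h) \<le> K * seq_norm X h"
    and Dadd: "\<And>h h'. h \<in> seqs X \<Longrightarrow> h' \<in> seqs X \<Longrightarrow> D (\<lambda>k. h k + h' k) = D h + D h'"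
    and Dscale: "\<And>c h. h \<in> seqs X \<Longrightarrow> D (\<lambda>k. c * h k) = c * D h"
    using D unfolding has_frechet_derivative_seq_def bounded_clinear_seq_def scaleC_complex_def by blast
  have "((\<lambda>s. (u (b (z + s)) - u (b z)) / s) \<longlongrightarrow> D b') (at 0)"
  proof (rule tendstoI)
    fix e :: real assume e: "e > 0"
    \<comment> \<open>\<open>q\<close> is tuned so that the error of \<open>u\<close> is at most
      \<open>e / 2 * cmod s\<close>, and \<open>r\<close> so that \<open>D h2\<close> contributes at
      most \<open>e / 4 * cmod s\<close>. The cap \<open>r \<le> 1\<close> lets
      \<open>(B1 + 1) * cmod s * w k\<close> dominate the increment.\<close>
    define q where "q = e / (2 * (C * (B1 + 1)))"
    define r where "r = min 1 (e / (4 * C * (\<bar>K\<bar> + 1)))"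
    have den: "C * (B1 + 1) > 0" "C * (\<bar>K\<bar> + 1) > 0" using C(1) B1_nn by auto
    have q: "q > 0" unfolding q_def using e den by (intro divide_pos_pos) auto
    have r: "r > 0" "r \<le> 1" unfolding r_def using e C(1) by (auto intro!: divide_pos_pos)
    obtain d where d: "d > 0" "\<And>h. h \<in> seqs X \<Longrightarrow> seq_norm X h < d \<Longrightarrow>
        norm (u (\<lambda>k. b z k + h k) - u (b z) - D h) \<le> q * seq_norm X h"
      using D q unfolding has_frechet_derivative_seq_def by blast
    have ev1: "eventually (\<lambda>s::complex. C * (B1 + 1) * cmod s < d) (at 0)"
    proof -
      have "((\<lambda>s::complex. C * (B1 + 1) * cmod s) \<longlongrightarrow> C * (B1 + 1) * cmod 0) (at 0)"
        by (intro tendsto_intros)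
      then show ?thesis using d(1) by (intro order_tendstoD(2)[of _ 0]) auto
    qed
    have ev2: "eventually (\<lambda>s::complex. s \<noteq> 0) (at 0)" by (simp add: eventually_at_filter)
    show "eventually (\<lambda>s. dist ((u (b (z + s)) - u (b z)) / s) (D b') < e) (at 0)"
      using b[OF r(1)] ev1 ev2
    proof eventually_elim
      case (elim s)
      define h where "h = (\<lambda>k. b (z + s) k - b z k)"
      define h2 where "h2 = (\<lambda>k. h k - s * b' k)"
      have h2: "h2 \<in> seqs X \<and> seq_norm X h2 \<le> C * (r * cmod s)"
        by (rule C(2)) (use elim(1) r in \<open>auto simp: h2_def h_def\<close>)
      have sb: "(\<lambda>k. s * b' k) \<in> seqs X \<and> seq_norm X (\<lambda>k. s * b' k) \<le> C * (B1 * cmod s)"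
      proof (rule C(2))
        show "cmod (s * b' k) \<le> B1 * cmod s * w k" for k
          using mult_left_mono[OF B1[of k], of "cmod s"] by (simp add: norm_mult mult_ac)
      qed (use B1_nn in auto)
      have h: "h \<in> seqs X \<and> seq_norm X h \<le> C * ((B1 + 1) * cmod s)"
      proof (rule C(2))
        fix k
        have "cmod (h k) \<le> cmod (h2 k) + cmod (s * b' k)"
          using norm_triangle_ineq[of "h2 k" "s * b' k"] by (simp add: h2_def)
        also have "cmod (h2 k) \<le> r * cmod s * w k" using elim(1) by (simp add: h2_def h_def)
        also have "r * cmod s * w k \<le> 1 * cmod s * w k"
          using r w(2)[of k] by (intro mult_right_mono) auto
        also have "cmod (s * b' k) \<le> cmod s * (B1 * w k)"
          using mult_left_mono[OF B1[of k], of "cmod s"] by (simp add: norm_mult)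
        finally show "cmod (h k) \<le> (B1 + 1) * cmod s * w k" by (simp add: algebra_simps)
      qed (use B1_nn in auto)
      have Dh: "D h = D h2 + s * D b'"
        using Dadd[of h2 "\<lambda>k. s * b' k"] h2 sb Dscale[OF b'X, of s] by (simp add: h2_def)
      have "(\<lambda>k. b z k + h k) = b (z + s)" by (auto simp: h_def)
      moreover have "seq_norm X h < d" using h elim(2) by (simp add: mult.assoc)
      ultimately have "norm (u (b (z + s)) - u (b z) - D h) \<le> q * seq_norm X h"
        using d(2)[of h] h by simp
      also have "\<dots> \<le> q * (C * ((B1 + 1) * cmod s))" using h q by (intro mult_left_mono) auto
      also have "\<dots> = e / 2 * cmod s" using den C(1) B1_nn by (simp add: q_def field_simps)
      finally have 1: "norm (u (b (z + s)) - u (b z) - D h) \<le> e / 2 * cmod s" .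
      have "norm (D h2) \<le> (\<bar>K\<bar> + 1) * seq_norm X h2"
        using K[of h2] h2 seq_norm_nonneg[of h2] by (smt (verit) mult_right_mono)
      also have "\<dots> \<le> (\<bar>K\<bar> + 1) * (C * (r * cmod s))" using h2 by (intro mult_left_mono) auto
      also have "\<dots> \<le> (\<bar>K\<bar> + 1) * (C * ((e / (4 * C * (\<bar>K\<bar> + 1))) * cmod s))"
        using C(1) by (intro mult_left_mono mult_right_mono) (auto simp: r_def)
      also have "\<dots> = e / 4 * cmod s" 
      proof -
        have "\<bar>K\<bar> + 1 \<noteq> 0" by linarith
        then show ?thesis using C(1) by (simp add: divide_simps)
      qed
      finally have 2: "norm (D h2) \<le> e / 4 * cmod s" .
      have "norm (u (b (z + s)) - u (b z) - s * D b')
          \<le> norm (u (b (z + s)) - u (b z) - D h) + norm (D h2)"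
        using norm_triangle_ineq[of "u (b (z + s)) - u (b z) - D h" "D h2"]
        by (simp add: Dh algebra_simps)
      also have "\<dots> \<le> e / 2 * cmod s + e / 4 * cmod s" using 1 2 by linarith
      also have "\<dots> < e * cmod s" using e elim(3) by (simp add: field_simps)
      finally have "norm (u (b (z + s)) - u (b z) - s * D b') / cmod s < e"
        using elim(3) by (simp add: field_simps)
      moreover have "(u (b (z + s)) - u (b z)) / s - D b' = (u (b (z + s)) - u (b z) - s * D b') / s"
        using elim(3) by (simp add: field_simps)
      ultimately show ?case by (simp add: dist_norm norm_divide)
    qed
  qed
  then show ?thesis by (simp add: DERIV_def)
qed

text \<open>The box is compact in the product topology, and on it \<open>f\<close> is locally
  bounded for that topology: since \<open>r\<close> is negligible against \<open>w\<close>, all but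
  finitely many coordinates of two points of the box differ by little relative to \<open>w\<close>.
  Restricting the remaining coordinates thus makes the difference small in norm, and a finite
  subcover gives \<open>M\<close>.\<close>

lemma holomorphic_seq_bounded_on_compact_box:
  fixes f :: "(nat \<Rightarrow> complex) \<Rightarrow> 'b::complex_normed_vector" and w r :: "nat \<Rightarrow> real"
  assumes w: "summable w" "\<And>k. 0 < w k"
    and r: "(\<lambda>k. r k / w k) \<longlonglongrightarrow> 0"
    and f: "holomorphic_seq X (seqs X) f"
  obtains M where "\<And>x. (\<And>k. cmod (x k) \<le> r k) \<Longrightarrow> norm (f x) \<le> M"
proof -
  define K where "K = {x. \<forall>k. cmod (x k) \<le> r k}"
  have "K = PiE UNIV (\<lambda>k. cball 0 (r k))" by (auto simp: K_def PiE_UNIV_domain)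
  moreover have "compactin (product_topology (\<lambda>k. euclidean) UNIV) (PiE UNIV (\<lambda>k. cball (0::complex) (r k)))"
    by (subst compactin_PiE) auto
  ultimately have cK: "compact K" by (simp add: euclidean_product_topology)
  obtain C where C: "C > 0"
    "\<And>h B. 0 \<le> B \<Longrightarrow> (\<And>k. cmod (h k) \<le> B * w k) \<Longrightarrow> h \<in> seqs X \<and> seq_norm X h \<le> C * B"
    using dominated_seq[OF w(1) less_imp_le[OF w(2)]] by blast
  have KX: "K \<subseteq> seqs X"
  proof
    fix x assume x: "x \<in> K"
    from r have "Bseq (\<lambda>k. r k / w k)" by (intro convergent_imp_Bseq) (auto simp: convergent_def)
    then obtain B where B: "B > 0" "\<And>k. norm (r k / w k) \<le> B" unfolding Bseq_def by blast
    have "cmod (x k) \<le> B * w k" for k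
    proof -
      have "r k / w k \<le> B" using B(2)[of k] unfolding real_norm_def by linarith
      then have "r k \<le> B * w k" using w(2)[of k] by (simp add: field_simps)
      then show ?thesis using x unfolding K_def by (auto intro: order_trans)
    qed
    then show "x \<in> seqs X" using C(2)[of B x] B(1) by simp
  qed
  have "\<exists>V b. open V \<and> x \<in> V \<and> (\<forall>y\<in>V \<inter> K. norm (f y) \<le> b)" if x: "x \<in> K" for x
  proof -
    obtain D where "has_frechet_derivative_seq X f D x"
      using f x KX unfolding holomorphic_seq_def by blast
    then obtain L d where L: "L > 0" and d: "d > 0" and Ld:
      "\<And>h. h \<in> seqs X \<Longrightarrow> seq_norm X h < d \<Longrightarrow> norm (f (\<lambda>k. x k + h k) - f x) \<le> L * seq_norm X h"
      using frechet_derivative_seq_lipschitz by blast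
    define q where "q = d / (2 * C)"
    have q: "q > 0" "C * q < d" using d C(1) by (auto simp: q_def)
    have "eventually (\<lambda>k. r k / w k < q / 2) sequentially"
      using r q by (intro order_tendstoD(2)[of _ 0]) auto
    then obtain m where m: "\<And>k. k \<ge> m \<Longrightarrow> r k / w k < q / 2"
      unfolding eventually_sequentially by blast
    \<comment> \<open>Only the first \<open>m\<close> coordinates are constrained; from
      \<open>m\<close> on, \<open>2 * r k\<close> is already below \<open>q * w k\<close>.\<close>
    define V where "V = (\<Inter>k\<in>{..<m}. {y. cmod (y k - x k) < q * w k})"
    have "open V" unfolding V_def
      by (intro open_INT ballI open_Collect_less continuous_intros) auto
    moreover have "x \<in> V" using q w(2) by (auto simp: V_def)
    moreover have "norm (f y) \<le> norm (f x) + L * d" if y: "y \<in> V \<inter> K" for y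
    proof -
      define h where "h = (\<lambda>k. y k - x k)"
      have "cmod (h k) \<le> q * w k" for k
      proof (cases "k < m")
        case True
        then show ?thesis using y by (auto simp: V_def h_def intro: less_imp_le)
      next
        case False
        have "cmod (h k) \<le> cmod (y k) + cmod (x k)" unfolding h_def by (rule norm_triangle_ineq4)
        also have "\<dots> \<le> 2 * r k" using x y unfolding K_def by (smt (verit) IntD2 mem_Collect_eq)
        also have "\<dots> \<le> q * w k" using m[of k] False w(2)[of k] by (simp add: field_simps)
        finally show ?thesis .
      qed
      then have h: "h \<in> seqs X" "seq_norm X h \<le> C * q" using C(2)[of q h] q by auto
      have "(\<lambda>k. x k + h k) = y" by (auto simp: h_def)
      then have "norm (f y - f x) \<le> L * seq_norm X h" using Ld[of h] h q by simp
      also have "\<dots> \<le> L * d" using h q L by (intro mult_left_mono) auto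
      finally show ?thesis using norm_triangle_ineq2[of "f y" "f x"] by linarith
    qed
    ultimately show ?thesis by blast
  qed
  then obtain V b where V: "\<And>x. x \<in> K \<Longrightarrow> open (V x)" "\<And>x. x \<in> K \<Longrightarrow> x \<in> V x"
    and b: "\<And>x y. x \<in> K \<Longrightarrow> y \<in> V x \<inter> K \<Longrightarrow> norm (f y) \<le> b x"
    by metis
  obtain K' where K': "K' \<subseteq> K" "finite K'" "K \<subseteq> (\<Union>x\<in>K'. V x)"
    by (rule compactE_image[OF cK, of K V]) (use V in auto)
  show thesis
  \<comment> \<open>The sum replaces the maximum over the finite subcover, so that an empty box
    needs no separate case.\<close>
  proof (rule that[of "\<Sum>x\<in>K'. \<bar>b x\<bar>"])
    fix y assume "\<And>k. cmod (y k) \<le> r k"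
    then have y: "y \<in> K" by (simp add: K_def)
    then obtain x where x: "x \<in> K'" "y \<in> V x" using K' by blast
    then have "norm (f y) \<le> b x" using b[of x y] y K'(1) by blast
    also have "\<dots> \<le> \<bar>b x\<bar>" by simp
    also have "\<dots> \<le> (\<Sum>x\<in>K'. \<bar>b x\<bar>)" using x K'(2) by (intro member_le_sum) auto
    finally show "norm (f y) \<le> (\<Sum>x\<in>K'. \<bar>b x\<bar>)" .
  qed
qed

end

section \<open>Estimates for entire functions of one variable\<close>

text \<open>Cauchy's inequality on discs of radius \<open>R / 2\<close> centred in the unit disc
  bounds the derivative by \<open>2 * B / R\<close>; these discs stay within radius \<open>R\<close>
  because \<open>R \<ge> 2\<close>. Convexity of the unit disc transfers the bound to the
  increment.\<close>

lemma entire_increment_bound: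
  fixes f :: "complex \<Rightarrow> complex"
  assumes f: "f holomorphic_on UNIV" and R: "R \<ge> 2" and B: "\<And>t. cmod t \<le> R \<Longrightarrow> cmod (f t) \<le> B"
  shows "cmod (f 1 - f 0) \<le> 2 * B / R"
proof -
  have "cmod (deriv f t) \<le> 2 * B / R" if t: "cmod t \<le> 1" for t
  proof -
    have "cmod ((deriv ^^ 1) f t) \<le> fact 1 * B / (R / 2) ^ 1"
    proof (rule Cauchy_inequality)
      show "f holomorphic_on ball t (R / 2)" using f holomorphic_on_subset by blast
      show "continuous_on (cball t (R / 2)) f"
        using f holomorphic_on_imp_continuous_on holomorphic_on_subset by blast
      show "0 < R / 2" using R by simp
      fix x assume "cmod (t - x) = R / 2"
      then have "cmod x \<le> 1 + R / 2" using t norm_triangle_ineq4[of t "t - x"] by simp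
      then show "cmod (f x) \<le> B" using R by (intro B) linarith
    qed
    then show ?thesis by (simp add: mult.commute)
  qed
  moreover have "(f has_field_derivative deriv f z) (at z within cball 0 1)" for z
    using holomorphic_derivI[OF f, of z] has_field_derivative_at_within by blast
  ultimately have "cmod (f 1 - f 0) \<le> 2 * B / R * cmod (1 - 0)"
    by (intro field_differentiable_bound[of "cball 0 1" f "deriv f"]) auto
  then show ?thesis by simp
qed

text \<open>The limit makes 0 a removable singularity of \<open>P z / z ^ N\<close> with value
  \<open>c\<close>, so the maximum principle on the disc of radius \<open>R\<close> bounds
  \<open>c\<close> by the values on the circle.\<close>

lemma leading_coefficient_bound:
  fixes P :: "complex \<Rightarrow> complex"
  assumes P: "P holomorphic_on UNIV" and lim: "((\<lambda>z. P z / z ^ N) \<longlongrightarrow> c) (at 0)"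
    and R: "R > 0" and B: "\<And>z. cmod z = R \<Longrightarrow> cmod (P z) \<le> B"
  shows "cmod c \<le> B / R ^ N"
proof -
  define Q where "Q = (\<lambda>z. if z = 0 then c else P z / z ^ N)"
  have Q1: "Q holomorphic_on (UNIV - {0})"
  proof (rule holomorphic_transform)
    show "(\<lambda>z. P z / z ^ N) holomorphic_on UNIV - {0}"
      by (intro holomorphic_intros holomorphic_on_subset[OF P]) auto
  qed (auto simp: Q_def)
  have Q2: "continuous_on UNIV Q"
  proof (rule continuous_at_imp_continuous_on, rule ballI)
    fix z :: complex
    show "isCont Q z"
    proof (cases "z = 0")
      case True
      have "(Q \<longlongrightarrow> c) (at 0)"
        using lim by (rule Lim_transform_eventually) (auto simp: Q_def eventually_at_filter)
      then show ?thesis using True by (simp add: isCont_def Q_def)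
    next
      case False
      then show ?thesis
        using holomorphic_on_imp_continuous_on[OF Q1] continuous_on_eq_continuous_at[of "UNIV - {0}" Q]
        by (auto simp: open_delete)
    qed
  qed
  have Q: "Q holomorphic_on UNIV" by (rule no_isolated_singularity[OF Q2 Q1]) auto
  have "norm (Q 0) \<le> B / R ^ N"
  proof (rule maximum_modulus_frontier[of Q "cball 0 R"])
    show "Q holomorphic_on interior (cball 0 R)" using Q holomorphic_on_subset by blast
    show "continuous_on (closure (cball 0 R)) Q" using Q2 continuous_on_subset by blast
    fix z assume "z \<in> frontier (cball (0::complex) R)"
    then have z: "cmod z = R" by (auto simp: frontier_def)
    then show "norm (Q z) \<le> B / R ^ N"
      using B[OF z] R by (auto simp: Q_def norm_divide norm_power divide_right_mono)
  qed (use R in auto)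
  then show ?thesis by (simp add: Q_def)
qed

section \<open>The weight of the curve and its truncations\<close>

text \<open>The moduli of the coordinates of \<open>alpha 1\<close>. They dominate the whole curve
  over the closed disc and serve as the common weight for domination.\<close>

definition square_weight :: "nat \<Rightarrow> real" where
  "square_weight k = 1 / (real (k + 1))\<^sup>2"

text \<open>Keeping finitely many coordinates gives a polynomial curve with values in the space for
  every \<open>z\<close>, whereas \<open>alpha z\<close> itself leaves the space for
  \<open>cmod z > 1\<close>.\<close>

definition alpha_trunc :: "nat \<Rightarrow> complex \<Rightarrow> nat \<Rightarrow> complex" where
  "alpha_trunc n z k = (if k < n then alpha z k else 0)"

definition unit_seq :: "nat \<Rightarrow> nat \<Rightarrow> complex" where
  "unit_seq n k = (if k = n then 1 else 0)"

lemma square_weight_pos: "0 < square_weight k"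
  unfolding square_weight_def by (intro divide_pos_pos zero_less_power) simp_all

lemma summable_square_weight: "summable square_weight"
proof -
  have "summable (\<lambda>k. inverse (real (Suc k) ^ 2))"
    using inverse_power_summable[of 2, where 'a = real] summable_Suc_iff[of "\<lambda>k. inverse (real k ^ 2)"] by simp
  moreover have "(\<lambda>k. inverse (real (Suc k) ^ 2)) = square_weight"
    by (auto simp: square_weight_def inverse_eq_divide)
  ultimately show ?thesis by simp
qed

lemma norm_alpha: "cmod (alpha z k) = cmod z ^ fact (k + 1) * square_weight k"
proof -
  have "cmod (of_nat (k + 1)) = real (k + 1)" by (rule norm_of_nat)
  then show ?thesis
    by (simp only: alpha_def square_weight_def norm_divide norm_power times_divide_eq_right mult_1_right)
qed

lemma norm_alpha_le:
  assumes "cmod z \<le> 1" "m \<le> fact (k + 1)"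
  shows "cmod (alpha z k) \<le> cmod z ^ m * square_weight k"
  unfolding norm_alpha using assms
  by (intro mult_right_mono power_decreasing less_imp_le[OF square_weight_pos]) auto

lemma finite_support_dominated:
  fixes b :: "nat \<Rightarrow> complex"
  assumes "\<And>k. k \<ge> n \<Longrightarrow> b k = 0"
  obtains B where "B \<ge> 0" "\<And>k. cmod (b k) \<le> B * square_weight k"
proof (rule that[of "\<Sum>k<n. cmod (b k) / square_weight k"])
  show "0 \<le> (\<Sum>k<n. cmod (b k) / square_weight k)"
    by (intro sum_nonneg divide_nonneg_pos) (auto simp: square_weight_pos)
  fix k
  show "cmod (b k) \<le> (\<Sum>k<n. cmod (b k) / square_weight k) * square_weight k"
  proof (cases "k < n")
    case True
    have "cmod (b k) / square_weight k \<le> (\<Sum>k<n. cmod (b k) / square_weight k)"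
      using True by (intro member_le_sum divide_nonneg_pos) (auto simp: square_weight_pos)
    then show ?thesis using square_weight_pos[of k] by (simp add: field_simps)
  next
    case False
    then show ?thesis using assms[of k] \<open>0 \<le> _\<close> square_weight_pos[of k] by simp
  qed
qed

section \<open>Functions on the space that vanish on the curve\<close>

context classical_seq_space
begin

lemma square_dominated_seq:
  obtains C where "C > 0"
    and "\<And>h B. 0 \<le> B \<Longrightarrow> (\<And>k. cmod (h k) \<le> B * square_weight k) \<Longrightarrow>
      h \<in> seqs X \<and> seq_norm X h \<le> C * B"
  using dominated_seq[OF summable_square_weight less_imp_le[OF square_weight_pos]] by blast

lemma dominated_in_seqs: "(\<And>k. cmod (h k) \<le> B * square_weight k) \<Longrightarrow> h \<in> seqs X"
proof -
  assume h: "\<And>k. cmod (h k) \<le> B * square_weight k"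
  \<comment> \<open>The bound at a single index already forces \<open>B\<close> to be nonnegative,
    as domination requires.\<close>
  then have "0 \<le> B * square_weight 0" using norm_ge_zero order_trans by blast
  then have "0 \<le> B" using square_weight_pos[of 0] by (simp add: zero_le_mult_iff)
  then show ?thesis using h square_dominated_seq by metis
qed

lemma finite_support_in_seqs: "(\<And>k. k \<ge> n \<Longrightarrow> h k = 0) \<Longrightarrow> h \<in> seqs X"
  by (metis finite_support_dominated dominated_in_seqs)

lemma alpha_in_seqs: "cmod z \<le> 1 \<Longrightarrow> alpha z \<in> seqs X"
  using norm_alpha_le[of z 0] by (intro dominated_in_seqs[of _ 1]) simp

text \<open>The chain rule along the truncated curve. Only finitely many coordinates move, so their
  separate differentiability is automatically uniform relative to the positive weight.\<close>

lemma holomorphic_alpha_trunc: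
  fixes u :: "(nat \<Rightarrow> complex) \<Rightarrow> complex"
  assumes "holomorphic_seq X (seqs X) u"
  shows "(\<lambda>z. u (alpha_trunc n z)) holomorphic_on UNIV"
proof (unfold holomorphic_on_open[OF open_UNIV], rule ballI)
  fix z :: complex
  have "alpha_trunc n z \<in> seqs X" by (rule finite_support_in_seqs[of n]) (simp add: alpha_trunc_def)
  then obtain D where D: "has_frechet_derivative_seq X u D (alpha_trunc n z)"
    using assms unfolding holomorphic_seq_def by blast
  define b' where "b' = (\<lambda>k. if k < n then deriv (\<lambda>z. alpha z k) z else 0)"
  obtain B where B: "\<And>k. cmod (b' k) \<le> B * square_weight k"
    by (rule finite_support_dominated[of n b']) (auto simp: b'_def)
  have hol: "((\<lambda>z. alpha z k) has_field_derivative deriv (\<lambda>z. alpha z k) z) (at z)" for k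
    unfolding alpha_def by (rule holomorphic_derivI[of _ UNIV], intro holomorphic_intros) (auto simp del: of_nat_Suc of_nat_add)
  have "((\<lambda>z. u (alpha_trunc n z)) has_field_derivative D b') (at z)"
  proof (rule has_frechet_derivative_seq_chain[where b = "alpha_trunc n" and z = z, OF summable_square_weight less_imp_le[OF square_weight_pos] D B])
    fix e :: real assume e: "e > 0"
    have "eventually (\<lambda>s. cmod (alpha (z + s) k - alpha z k - s * b' k) \<le> e * cmod s * square_weight k) (at 0)"
      if k: "k < n" for k
    proof -
      have "((\<lambda>s. (alpha (z + s) k - alpha z k) / s) \<longlongrightarrow> b' k) (at 0)"
        using hol[of k] k by (simp add: DERIV_def b'_def)
      then have "eventually (\<lambda>s. dist ((alpha (z + s) k - alpha z k) / s) (b' k) < e * square_weight k) (at 0)"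
        using e square_weight_pos[of k] by (intro tendstoD) auto
      moreover have "eventually (\<lambda>s::complex. s \<noteq> 0) (at 0)" by (simp add: eventually_at_filter)
      ultimately show ?thesis
      proof eventually_elim
        case (elim s)
        have "alpha (z + s) k - alpha z k - s * b' k = s * ((alpha (z + s) k - alpha z k) / s - b' k)"
          using elim(2) by (simp add: field_simps)
        then have "cmod (alpha (z + s) k - alpha z k - s * b' k)
            = cmod s * dist ((alpha (z + s) k - alpha z k) / s) (b' k)"
          by (simp only: norm_mult dist_norm)
        also have "\<dots> \<le> cmod s * (e * square_weight k)" using elim(1) by (intro mult_left_mono) auto
        finally show ?case by (simp add: mult_ac)
      qed
    qed
    then have "eventually (\<lambda>s. \<forall>k\<in>{..<n}. cmod (alpha (z + s) k - alpha z k - s * b' k)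
        \<le> e * cmod s * square_weight k) (at 0)"
      by (intro eventually_ball_finite) auto
    then show "eventually (\<lambda>s. \<forall>k. cmod (alpha_trunc n (z + s) k - alpha_trunc n z k - s * b' k)
        \<le> e * cmod s * square_weight k) (at 0)"
    proof eventually_elim
      case (elim s)
      show ?case
      proof
        fix k
        show "cmod (alpha_trunc n (z + s) k - alpha_trunc n z k - s * b' k) \<le> e * cmod s * square_weight k"
          using elim e square_weight_pos[of k] by (cases "k < n") (auto simp: alpha_trunc_def b'_def)
      qed
    qed
  qed
  then show "\<exists>f'. ((\<lambda>z. u (alpha_trunc n z)) has_field_derivative f') (at z)" ..
qed

text \<open>On an affine line the first-order error is identically 0, so the chain rule applies with
  velocity \<open>h\<close>.\<close>

lemma holomorphic_line:
  fixes u :: "(nat \<Rightarrow> complex) \<Rightarrow> complex"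
  assumes u: "holomorphic_seq X (seqs X) u"
    and y: "\<And>k. cmod (y k) \<le> A * square_weight k" and h: "\<And>k. cmod (h k) \<le> B * square_weight k"
  shows "(\<lambda>t. u (\<lambda>k. y k + t * h k)) holomorphic_on UNIV"
proof (unfold holomorphic_on_open[OF open_UNIV], rule ballI)
  fix t :: complex
  have "(\<lambda>k. y k + t * h k) \<in> seqs X"
  proof (rule dominated_in_seqs)
    fix k
    have "cmod (y k + t * h k) \<le> cmod (y k) + cmod t * cmod (h k)"
      using norm_triangle_ineq[of "y k" "t * h k"] by (simp add: norm_mult)
    also have "\<dots> \<le> A * square_weight k + cmod t * (B * square_weight k)"
      using y h by (intro add_mono mult_left_mono) auto
    finally show "cmod (y k + t * h k) \<le> (A + cmod t * B) * square_weight k" by (simp add: algebra_simps)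
  qed
  then obtain D where D: "has_frechet_derivative_seq X u D (\<lambda>k. y k + t * h k)"
    using u unfolding holomorphic_seq_def by blast
  have "((\<lambda>t. u ((\<lambda>t k. y k + t * h k) t)) has_field_derivative D h) (at t)"
    by (rule has_frechet_derivative_seq_chain[where b = "\<lambda>t k. y k + t * h k" and z = t, OF summable_square_weight less_imp_le[OF square_weight_pos] D h])
      (auto simp: algebra_simps less_imp_le[OF square_weight_pos])
  then show "\<exists>f'. ((\<lambda>t. u (\<lambda>k. y k + t * h k)) has_field_derivative f') (at t)" ..
qed

text \<open>Split \<open>alpha z\<close> into its truncation \<open>y\<close> and its tail
  \<open>h\<close>. As \<open>u (alpha z) = 0\<close>, the value \<open>u y\<close> should be close
  to \<open>- D h\<close>, and \<open>D h\<close> has leading term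
  \<open>z ^ fact (n + 1) * D (unit_seq n)\<close> divided by the square of \<open>n + 1\<close>.
  For \<open>n \<ge> 1\<close>, differentiability at 0 alone controls the error only relative to
  sequences of order \<open>cmod z\<close>, whereas it must be small against the far smaller
  \<open>cmod z ^ fact (n + 1)\<close>.\<close>

lemma alpha_trunc_asymptotics:
  fixes u :: "(nat \<Rightarrow> complex) \<Rightarrow> complex"
  assumes u: "holomorphic_seq X (seqs X) u"
    and vanish: "\<And>z. cmod z \<le> 1 \<Longrightarrow> u (alpha z) = 0"
    and D: "has_frechet_derivative_seq X u D (\<lambda>_. 0)"
  shows "((\<lambda>z. u (alpha_trunc n z) / z ^ fact (n + 1))
      \<longlongrightarrow> - (D (unit_seq n) / (of_nat (n + 1))\<^sup>2)) (at 0)"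
proof (rule tendstoI)
  fix e :: real assume e: "e > 0"
  define N :: nat where "N = fact (n + 1)"
  have N: "N \<ge> 1" unfolding N_def by (rule fact_ge_1)
  define c where "c = D (unit_seq n) / (of_nat (n + 1))\<^sup>2"
  obtain C where C: "C > 0"
    "\<And>h B. 0 \<le> B \<Longrightarrow> (\<And>k. cmod (h k) \<le> B * square_weight k) \<Longrightarrow>
      h \<in> seqs X \<and> seq_norm X h \<le> C * B"
    using square_dominated_seq by blast
  obtain K0 where K0: "\<And>h. h \<in> seqs X \<Longrightarrow> norm (D h) \<le> K0 * seq_norm X h"
    and Dadd: "\<And>h h'. h \<in> seqs X \<Longrightarrow> h' \<in> seqs X \<Longrightarrow> D (\<lambda>k. h k + h' k) = D h + D h'"
    and Dscale: "\<And>c h. h \<in> seqs X \<Longrightarrow> D (\<lambda>k. c * h k) = c * D h"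
    using D unfolding has_frechet_derivative_seq_def bounded_clinear_seq_def scaleC_complex_def by blast
  define K where "K = \<bar>K0\<bar>"
  have K: "norm (D h) \<le> K * seq_norm X h" if "h \<in> seqs X" for h
    using K0[OF that] seq_norm_nonneg[OF that] by (smt (verit) K_def mult_right_mono)
  have K_nn: "K \<ge> 0" by (simp add: K_def)
  have "alpha 0 = (\<lambda>_. 0)" by (auto simp: alpha_def)
  then have u0: "u (\<lambda>_. 0) = 0" using vanish[of 0] by simp
  \<comment> \<open>With this \<open>q\<close> and the radius \<open>R = r / cmod z ^ N\<close>
    below, the Cauchy bound \<open>2 * (q * (C * (2 * r))) / R\<close> equals
    \<open>e / 4 * cmod z ^ N\<close>.\<close>
  define q where "q = e / (16 * C)"
  have q: "q > 0" using e C(1) by (simp add: q_def)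
  obtain d where d: "d > 0" "\<And>h. h \<in> seqs X \<Longrightarrow> seq_norm X h < d \<Longrightarrow> norm (u h - D h) \<le> q * seq_norm X h"
    using D q u0 unfolding has_frechet_derivative_seq_def by auto
  \<comment> \<open>\<open>C * (2 * r)\<close> is half of \<open>d\<close>, so sequences dominated
    by \<open>2 * r\<close> times the weight stay where the estimate for \<open>u\<close>
    holds.\<close>
  define r where "r = d / (4 * C)"
  have r: "r > 0" "C * (2 * r) < d" using d(1) C(1) by (auto simp: r_def)
  have ev: "eventually (\<lambda>z::complex. cmod z < x) (at 0)" if "x > 0" for x
    using that by (auto simp: eventually_at dist_norm intro: exI[of _ x])
  have ev0: "eventually (\<lambda>z::complex. z \<noteq> 0) (at 0)" by (simp add: eventually_at_filter)
  have eK: "e / (4 * (C * (K + 1))) > 0" using e C(1) K_nn by (intro divide_pos_pos mult_pos_pos) auto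
  show "eventually (\<lambda>z. dist (u (alpha_trunc n z) / z ^ fact (n + 1))
      (- (D (unit_seq n) / (of_nat (n + 1))\<^sup>2)) < e) (at 0)"
    using ev[OF zero_less_one] ev[OF half_gt_zero[OF r(1)]] ev[OF eK] ev0
    unfolding N_def[symmetric] c_def[symmetric]
  proof eventually_elim
    case (elim z)
    define y where "y = alpha_trunc n z"
    define h where "h = (\<lambda>k. if k < n then 0 else alpha z k)"
    \<comment> \<open>\<open>h\<close> starts at index \<open>n\<close>, \<open>rest\<close> only at
      \<open>n + 1\<close>: the coordinate of index \<open>n\<close> carries the exponent
      \<open>N\<close>, and all later ones at least \<open>N + 1\<close>.\<close>
    define rest where "rest = (\<lambda>k. if k \<le> n then 0 else alpha z k)"
    have z1: "cmod z \<le> 1" using elim by simp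
    have zN: "cmod z ^ N \<le> r / 2"
      using power_decreasing[of 1 N "cmod z"] N elim by simp
    have zN0: "cmod z ^ N > 0" using elim by simp
    have y: "cmod (y k) \<le> cmod z * square_weight k" for k
      using norm_alpha_le[OF z1, of 1 k] square_weight_pos[of k] fact_ge_1[of "k + 1", where 'a = nat]
      by (auto simp: y_def alpha_trunc_def)
    have h: "cmod (h k) \<le> cmod z ^ N * square_weight k" for k
      using norm_alpha_le[OF z1, of N k] square_weight_pos[of k] fact_mono_nat[of "n + 1" "k + 1"]
      by (auto simp: h_def N_def)
    have rest: "cmod (rest k) \<le> (cmod z ^ (N + 1)) * square_weight k" for k
    proof (cases "k \<le> n")
      case True
      then show ?thesis using square_weight_pos[of k] by (simp add: rest_def)
    next
      case False
      then have "N + 1 \<le> fact (k + 1)" using fact_less_mono_nat[of "n + 1" "k + 1"] by (simp add: N_def)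
      then show ?thesis using norm_alpha_le[OF z1, of "N + 1" k] False by (simp add: rest_def)
    qed
    have yX: "y \<in> seqs X" and hX: "h \<in> seqs X" and restX: "rest \<in> seqs X"
      using dominated_in_seqs[OF y] dominated_in_seqs[OF h] dominated_in_seqs[OF rest] .
    have eX: "unit_seq n \<in> seqs X" by (rule finite_support_in_seqs[of "Suc n"]) (simp add: unit_seq_def)
    have ceX: "(\<lambda>k. alpha z n * unit_seq n k) \<in> seqs X"
      by (rule finite_support_in_seqs[of "Suc n"]) (simp add: unit_seq_def)
    have "h = (\<lambda>k. alpha z n * unit_seq n k + rest k)"
      by (auto simp: h_def rest_def unit_seq_def fun_eq_iff)
    then have "D h = alpha z n * D (unit_seq n) + D rest"
      using Dadd[OF ceX restX] Dscale[OF eX] by simp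
    also have "alpha z n * D (unit_seq n) = z ^ N * c"
      unfolding alpha_def c_def N_def by simp
    finally have Dh: "D h = z ^ N * c + D rest" .
    have "norm (D rest) \<le> K * seq_norm X rest" by (rule K[OF restX])
    also have "\<dots> \<le> K * (C * cmod z ^ (N + 1))" using C(2)[OF _ rest] K_nn by (intro mult_left_mono) auto
    also have "\<dots> \<le> (C * (K + 1) * cmod z) * cmod z ^ N"
    proof -
      have "K * (C * cmod z ^ (N + 1)) = (C * K * cmod z) * cmod z ^ N" by simp
      also have "\<dots> \<le> (C * (K + 1) * cmod z) * cmod z ^ N"
        using C(1) by (intro mult_right_mono mult_left_mono) auto
      finally show ?thesis .
    qed
    also have "C * (K + 1) * cmod z \<le> e / 4"
    proof -
      have "C * (K + 1) > 0" using C(1) K_nn by simp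
      then show ?thesis using elim by (simp add: field_simps)
    qed
    finally have Drest: "norm (D rest) \<le> e / 4 * cmod z ^ N" by (simp add: mult_right_mono)
    \<comment> \<open>For \<open>cmod t \<le> R\<close> the sequence \<open>t * h\<close> is
      dominated by \<open>r\<close> times the weight, so these points of the line lie where the
      derivative estimate is valid. The radius grows as \<open>cmod z ^ N\<close> shrinks, and this
      supplies the missing factor \<open>cmod z ^ N\<close> in the error.\<close>
    define R where "R = r / cmod z ^ N"
    have R: "R \<ge> 2" using zN zN0 by (simp add: R_def field_simps)
    \<comment> \<open>Cauchy's estimate on the complex line through \<open>y\<close> and \<open>alpha z\<close> upgrades differentiability
      at \<open>0\<close> to strict differentiability.\<close>
    define g where "g = (\<lambda>t. u (\<lambda>k. y k + t * h k) - (D y + t * D h))"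
    have ghol: "g holomorphic_on UNIV"
      unfolding g_def by (intro holomorphic_intros holomorphic_line[OF u y h])
    have gB: "cmod (g t) \<le> q * (C * (2 * r))" if t: "cmod t \<le> R" for t
    proof -
      have th: "(\<lambda>k. t * h k) \<in> seqs X"
      proof (rule dominated_in_seqs)
        show "cmod (t * h k) \<le> (cmod t * cmod z ^ N) * square_weight k" for k
          using mult_left_mono[OF h[of k], of "cmod t"] by (simp add: norm_mult mult.assoc)
      qed
      have x: "cmod (y k + t * h k) \<le> (2 * r) * square_weight k" for k
      proof -
        have "cmod (y k + t * h k) \<le> cmod (y k) + cmod t * cmod (h k)"
          using norm_triangle_ineq[of "y k" "t * h k"] by (simp add: norm_mult)
        also have "\<dots> \<le> cmod z * square_weight k + R * (cmod z ^ N * square_weight k)"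
          using y[of k] h[of k] t R by (intro add_mono mult_mono) auto
        also have "\<dots> = (cmod z + r) * square_weight k" using elim by (simp add: R_def field_simps)
        also have "\<dots> \<le> (2 * r) * square_weight k"
          using elim r(1) square_weight_pos[of k] by (intro mult_right_mono) auto
        finally show ?thesis .
      qed
      have n: "(\<lambda>k. y k + t * h k) \<in> seqs X" "seq_norm X (\<lambda>k. y k + t * h k) \<le> C * (2 * r)"
        using C(2)[OF _ x] r by auto
      have "D (\<lambda>k. y k + t * h k) = D y + t * D h" using Dadd[OF yX th] Dscale[OF hX] by simp
      then have "cmod (g t) \<le> q * seq_norm X (\<lambda>k. y k + t * h k)"
        using d(2)[OF n(1)] n(2) r(2) by (simp add: g_def)
      also have "\<dots> \<le> q * (C * (2 * r))" using n q by (intro mult_left_mono) auto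
      finally show ?thesis .
    qed
    \<comment> \<open>The parameter \<open>t = 1\<close> gives a point of the curve, where
      \<open>u\<close> vanishes, and \<open>t = 0\<close> gives the truncation; \<open>D y\<close>
      cancels in \<open>g 1 - g 0\<close>.\<close>
    have "(\<lambda>k. y k + 1 * h k) = alpha z" by (auto simp: y_def h_def alpha_trunc_def)
    then have g1: "g 1 = - D y - D h" using vanish[OF z1] by (simp add: g_def)
    have g0: "g 0 = u y - D y" by (simp add: g_def)
    have "cmod (g 1 - g 0) \<le> 2 * (q * (C * (2 * r))) / R"
      by (rule entire_increment_bound[OF ghol R gB])
    also have "\<dots> = e / 4 * cmod z ^ N"
      using C(1) r(1) zN0 by (simp add: q_def R_def field_simps)
    finally have g10: "cmod (- D h - u y) \<le> e / 4 * cmod z ^ N" by (simp add: g1 g0)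
    have "u y + z ^ N * c = - (- D h - u y) - D rest" by (simp add: Dh)
    then have "cmod (u y + z ^ N * c) \<le> cmod (- D h - u y) + cmod (D rest)"
      by (metis norm_minus_cancel norm_triangle_ineq4)
    also have "\<dots> \<le> e / 2 * cmod z ^ N" using g10 Drest by linarith
    also have "\<dots> < e * cmod z ^ N" using e zN0 by simp
    finally have "cmod (u y + z ^ N * c) / cmod z ^ N < e" using zN0 by (simp add: field_simps)
    moreover have "u y / z ^ N - (- c) = (u y + z ^ N * c) / z ^ N"
      using elim by (simp add: field_simps)
    ultimately show ?case by (simp add: dist_norm norm_divide norm_power y_def)
  qed
qed

text \<open>The leading coefficient of \<open>u\<close> along the truncated curve is bounded by its
  values on a circle. \<open>M\<close> belongs to one fixed box and is the same for every
  \<open>n\<close>, so the coordinates of the derivative decay like powers of 1/2 up to a quadratic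
  factor.\<close>

lemma derivative_coordinate_bound:
  fixes u :: "(nat \<Rightarrow> complex) \<Rightarrow> complex"
  assumes u: "holomorphic_seq X (seqs X) u"
    and vanish: "\<And>z. cmod z \<le> 1 \<Longrightarrow> u (alpha z) = 0"
    and D: "has_frechet_derivative_seq X u D (\<lambda>_. 0)"
    and M: "\<And>x. (\<And>k. cmod (x k) \<le> 2 * square_weight k) \<Longrightarrow> cmod (u x) \<le> M"
  shows "cmod (D (unit_seq n)) * 2 ^ (n + 1) \<le> M * (real (n + 1))\<^sup>2"
proof -
  \<comment> \<open>The \<open>fact n\<close>-th root of 2. The coordinates kept have exponents
    \<open>fact (k + 1)\<close> with \<open>k + 1 \<le> n\<close>, so the powers of \<open>R\<close>
    in them are at most 2, while the leading term gains
    \<open>R ^ fact (n + 1) = 2 ^ (n + 1)\<close>.\<close>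
  define R :: real where "R = 2 powr (1 / fact n)"
  have R0: "R > 0" by (simp add: R_def)
  have Rn: "R ^ fact n = 2"
    by (simp add: R_def powr_powr flip: powr_realpow)
  have R1: "R \<ge> 1" by (simp add: R_def ge_one_powr_ge_zero)
  have "cmod (- (D (unit_seq n) / (of_nat (n + 1))\<^sup>2)) \<le> M / R ^ fact (n + 1)"
  proof (rule leading_coefficient_bound[OF holomorphic_alpha_trunc[OF u]
        alpha_trunc_asymptotics[OF u vanish D] R0])
    fix z assume z: "cmod z = R"
    show "cmod (u (alpha_trunc n z)) \<le> M"
    proof (rule M)
      fix k
      show "cmod (alpha_trunc n z k) \<le> 2 * square_weight k"
      proof (cases "k < n")
        case True
        then have "R ^ fact (k + 1) \<le> R ^ fact n" using R1 by (intro power_increasing fact_mono_nat) auto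
        then show ?thesis
          using True z Rn square_weight_pos[of k] norm_alpha[of z k] by (simp add: alpha_trunc_def mult_right_mono)
      next
        case False
        then show ?thesis using square_weight_pos[of k] by (simp add: alpha_trunc_def)
      qed
    qed
  qed
  moreover have "R ^ fact (n + 1) = 2 ^ (n + 1)"
  proof -
    have "R ^ fact (n + 1) = (R ^ fact n) ^ (n + 1)" by (simp add: algebra_simps flip: power_mult power_add)
    then show ?thesis by (simp add: Rn)
  qed
  moreover have "cmod (- (D (unit_seq n) / (of_nat (n + 1))\<^sup>2)) = cmod (D (unit_seq n)) / (real (n + 1))\<^sup>2"
  proof -
    have "cmod (of_nat (n + 1)) = real (n + 1)" by (rule norm_of_nat)
    then show ?thesis by (simp only: norm_divide norm_minus_cancel norm_power)
  qed
  ultimately have "cmod (D (unit_seq n)) / (real (n + 1))\<^sup>2 \<le> M / 2 ^ (n + 1)" by simp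
  moreover have "(real (n + 1))\<^sup>2 > 0" by (intro zero_less_power) simp
  ultimately show ?thesis by (simp add: divide_le_eq pos_le_divide_eq mult.commute del: of_nat_add power_Suc)
qed

end

section \<open>Evaluation of operator-valued maps and directional derivatives\<close>

lemma scaleC_one: "1 *\<^sub>C x = x" for x :: "'a::complex_normed_vector"
  using scaleC_of_real[of 1 x] by simp

lemma scaleC_diff_right: "a *\<^sub>C (x - y) = a *\<^sub>C x - a *\<^sub>C y" for x :: "'a::complex_normed_vector"
  by (rule linear_diff[OF bounded_linear.linear[OF bounded_linear_scaleC]])

text \<open>Evaluation at \<open>v\<close> respects complex scalars and is bounded by
  \<open>norm v\<close>, so the derivative estimate for \<open>\<phi>\<close> with
  \<open>e / norm v\<close> becomes the one for the scalar function with \<open>e\<close>.\<close>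

lemma has_frechet_derivative_seq_blinfun_apply:
  fixes \<phi> :: "(nat \<Rightarrow> complex) \<Rightarrow> ('f::complex_banach \<Rightarrow>\<^sub>L complex)"
  assumes "has_frechet_derivative_seq X \<phi> D x"
  shows "has_frechet_derivative_seq X (\<lambda>x. blinfun_apply (\<phi> x) v) (\<lambda>h. blinfun_apply (D h) v) x"
proof -
  have D: "bounded_clinear_seq X D"
    "\<And>e. e > 0 \<Longrightarrow> \<exists>d>0. \<forall>h\<in>seqs X. seq_norm X h < d \<longrightarrow>
        norm (\<phi> (\<lambda>k. x k + h k) - \<phi> x - D h) \<le> e * seq_norm X h"
    using assms unfolding has_frechet_derivative_seq_def by blast+
  have le: "cmod (blinfun_apply T v) \<le> B * norm v" if "norm T \<le> B" for T :: "'f \<Rightarrow>\<^sub>L complex" and B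
    using norm_blinfun[of T v] that mult_right_mono[of "norm T" B "norm v"] by simp
  obtain K where K: "\<And>h. h \<in> seqs X \<Longrightarrow> norm (D h) \<le> K * seq_norm X h"
    using D(1) unfolding bounded_clinear_seq_def by blast
  have "cmod (blinfun_apply (D h) v) \<le> (K * norm v) * seq_norm X h" if "h \<in> seqs X" for h
    using le[OF K[OF that]] by (simp add: mult_ac)
  then have "bounded_clinear_seq X (\<lambda>h. blinfun_apply (D h) v)"
    using D(1) unfolding bounded_clinear_seq_def by (auto simp: blinfun.add_left blinfun_apply_scaleC)
  moreover have "\<exists>d>0. \<forall>h\<in>seqs X. seq_norm X h < d \<longrightarrow>
        norm (blinfun_apply (\<phi> (\<lambda>k. x k + h k)) v - blinfun_apply (\<phi> x) v - blinfun_apply (D h) v)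
        \<le> e * seq_norm X h" if e: "e > 0" for e
  proof (cases "v = 0")
    case True
    \<comment> \<open>What remains is \<open>0 \<le> e * seq_norm X h\<close>. It is read off from
      the estimate for \<open>\<phi>\<close>, whose left side is a norm, as \<open>X\<close> is
      arbitrary here.\<close>
    obtain d where "d > 0" "\<And>h. h \<in> seqs X \<Longrightarrow> seq_norm X h < d \<Longrightarrow>
        norm (\<phi> (\<lambda>k. x k + h k) - \<phi> x - D h) \<le> e * seq_norm X h" using D(2)[OF e] by blast
    then show ?thesis using True
      by (intro exI[of _ d]) (auto simp: blinfun.zero_right intro: order_trans[OF norm_ge_zero])
  next
    case False
    then have "e / norm v > 0" using e by simp
    then obtain d where d: "d > 0" "\<And>h. h \<in> seqs X \<Longrightarrow> seq_norm X h < d \<Longrightarrow>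
        norm (\<phi> (\<lambda>k. x k + h k) - \<phi> x - D h) \<le> e / norm v * seq_norm X h" using D(2) by blast
    have "norm (blinfun_apply (\<phi> (\<lambda>k. x k + h k)) v - blinfun_apply (\<phi> x) v - blinfun_apply (D h) v)
        \<le> e * seq_norm X h" if "h \<in> seqs X" "seq_norm X h < d" for h
      using le[OF d(2)[OF that]] False by (simp add: blinfun.diff_left)
    then show ?thesis using d(1) by blast
  qed
  ultimately show ?thesis unfolding has_frechet_derivative_seq_def by blast
qed

context classical_seq_space
begin

text \<open>For \<open>Lp p\<close> the triangle inequality is replaced by a cruder bound: a
  difference is at most twice the larger modulus, which costs a factor
  \<open>2 powr p\<close>.\<close>

lemma seqs_diff:
  assumes "x \<in> seqs X" "y \<in> seqs X"
  shows "(\<lambda>k. x k - y k) \<in> seqs X"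
  using X_cases
proof
  assume "\<exists>p\<ge>1. X = Lp p"
  then obtain p where p: "p \<ge> 1" and X: "X = Lp p" by blast
  have le: "cmod (x k - y k) powr p \<le> 2 powr p * (cmod (x k) powr p + cmod (y k) powr p)" for k
  proof -
    have "cmod (x k - y k) \<le> 2 * max (cmod (x k)) (cmod (y k))"
      using norm_triangle_ineq4[of "x k" "y k"] by simp
    then have "cmod (x k - y k) powr p \<le> (2 * max (cmod (x k)) (cmod (y k))) powr p"
      using p by (intro powr_mono2) auto
    also have "\<dots> = 2 powr p * max (cmod (x k)) (cmod (y k)) powr p"
      by (simp add: powr_mult)
    also have "\<dots> \<le> 2 powr p * (cmod (x k) powr p + cmod (y k) powr p)"
      by (intro mult_left_mono) (auto simp: max_def)
    finally show ?thesis .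
  qed
  have "summable (\<lambda>k. 2 powr p * (cmod (x k) powr p + cmod (y k) powr p))"
    using assms by (intro summable_mult summable_add) (auto simp: X)
  then have "summable (\<lambda>k. cmod (x k - y k) powr p)"
    by (rule summable_comparison_test'[where N = 0]) (use le in auto)
  then show ?thesis by (simp add: X)
next
  assume "X = C0"
  then show ?thesis using assms tendsto_diff[of x 0 sequentially y 0] by simp
qed

text \<open>The two limits are the ingredients of a product rule at 0 along \<open>v\<close>: one
  factor contributes its difference quotient, the other its continuity.\<close>

lemma frechet_derivative_seq_directional:
  fixes f :: "(nat \<Rightarrow> complex) \<Rightarrow> 'b::complex_normed_vector"
  assumes f: "has_frechet_derivative_seq X f D (\<lambda>_. 0)" and v: "\<And>k. cmod (v k) \<le> B * square_weight k"
  shows "((\<lambda>s. f (\<lambda>k. s * v k)) \<longlongrightarrow> f (\<lambda>_. 0)) (at 0)"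
    and "((\<lambda>s. inverse s *\<^sub>C (f (\<lambda>k. s * v k) - f (\<lambda>_. 0))) \<longlongrightarrow> D v) (at 0)"
proof -
  obtain C where C: "C > 0"
    "\<And>h B. 0 \<le> B \<Longrightarrow> (\<And>k. cmod (h k) \<le> B * square_weight k) \<Longrightarrow>
      h \<in> seqs X \<and> seq_norm X h \<le> C * B"
    using square_dominated_seq by blast
  define A where "A = C * (\<bar>B\<bar> + 1)"
  have A: "A > 0" using C(1) by (simp add: A_def)
  have sv: "(\<lambda>k. s * v k) \<in> seqs X \<and> seq_norm X (\<lambda>k. s * v k) \<le> A * cmod s" for s
  proof -
    have "cmod (s * v k) \<le> (cmod s * (\<bar>B\<bar> + 1)) * square_weight k" for k
    proof -
      have "cmod (v k) \<le> (\<bar>B\<bar> + 1) * square_weight k"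
        using v[of k] square_weight_pos[of k] by (smt (verit) mult_right_mono)
      from mult_left_mono[OF this, of "cmod s"] show ?thesis by (simp add: norm_mult mult.assoc)
    qed
    from C(2)[OF _ this] show ?thesis by (simp add: A_def mult_ac)
  qed
  have ev: "eventually (\<lambda>s::complex. A * cmod s < d) (at 0)" if "d > 0" for d
  proof -
    have "((\<lambda>s::complex. A * cmod s) \<longlongrightarrow> A * cmod 0) (at 0)" by (intro tendsto_intros)
    then show ?thesis using that by (intro order_tendstoD(2)[of _ 0]) auto
  qed
  have vX: "v \<in> seqs X" using sv[of 1] by simp
  obtain L d where L: "L > 0" and d: "d > 0" and Ld: "\<And>h. h \<in> seqs X \<Longrightarrow> seq_norm X h < d \<Longrightarrow>
      norm (f h - f (\<lambda>_. 0)) \<le> L * seq_norm X h"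
    using frechet_derivative_seq_lipschitz[OF f] by auto
  have "((\<lambda>s. f (\<lambda>k. s * v k) - f (\<lambda>_. 0)) \<longlongrightarrow> 0) (at 0)"
  proof (rule Lim_null_comparison)
    show "eventually (\<lambda>s. norm (f (\<lambda>k. s * v k) - f (\<lambda>_. 0)) \<le> L * (A * cmod s)) (at 0)"
      using ev[OF d]
    proof eventually_elim
      case (elim s)
      have "norm (f (\<lambda>k. s * v k) - f (\<lambda>_. 0)) \<le> L * seq_norm X (\<lambda>k. s * v k)"
        using sv[of s] elim by (intro Ld) auto
      also have "\<dots> \<le> L * (A * cmod s)" using sv[of s] L by (intro mult_left_mono) auto
      finally show ?case .
    qed
    have "((\<lambda>s::complex. L * (A * cmod s)) \<longlongrightarrow> L * (A * cmod 0)) (at 0)" by (intro tendsto_intros)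
    then show "((\<lambda>s::complex. L * (A * cmod s)) \<longlongrightarrow> 0) (at 0)" by simp
  qed
  then show "((\<lambda>s. f (\<lambda>k. s * v k)) \<longlongrightarrow> f (\<lambda>_. 0)) (at 0)" by (simp add: Lim_null[symmetric])
  show "((\<lambda>s. inverse s *\<^sub>C (f (\<lambda>k. s * v k) - f (\<lambda>_. 0))) \<longlongrightarrow> D v) (at 0)"
  proof (rule tendstoI)
    fix e :: real assume e: "e > 0"
    then have "e / (2 * A) > 0" using A by simp
    then obtain d where d: "d > 0" and fd: "\<And>h. h \<in> seqs X \<Longrightarrow> seq_norm X h < d \<Longrightarrow>
        norm (f h - f (\<lambda>_. 0) - D h) \<le> e / (2 * A) * seq_norm X h"
      using f unfolding has_frechet_derivative_seq_def by (metis (no_types, lifting) add_0 ext)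
    have ev0: "eventually (\<lambda>s::complex. s \<noteq> 0) (at 0)" by (simp add: eventually_at_filter)
    show "eventually (\<lambda>s. dist (inverse s *\<^sub>C (f (\<lambda>k. s * v k) - f (\<lambda>_. 0))) (D v) < e) (at 0)"
      using ev[OF d] ev0
    proof eventually_elim
      case (elim s)
      have Ds: "D (\<lambda>k. s * v k) = s *\<^sub>C D v"
        using f vX unfolding has_frechet_derivative_seq_def bounded_clinear_seq_def by blast
      have "inverse s *\<^sub>C (f (\<lambda>k. s * v k) - f (\<lambda>_. 0)) - D v
          = inverse s *\<^sub>C (f (\<lambda>k. s * v k) - f (\<lambda>_. 0) - D (\<lambda>k. s * v k))"
        using elim(2) by (simp add: Ds scaleC_diff_right scaleC_scaleC scaleC_one)
      then have "dist (inverse s *\<^sub>C (f (\<lambda>k. s * v k) - f (\<lambda>_. 0))) (D v)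
          = norm (f (\<lambda>k. s * v k) - f (\<lambda>_. 0) - D (\<lambda>k. s * v k)) / cmod s"
        by (simp add: dist_norm norm_scaleC norm_inverse divide_inverse mult.commute)
      also have "\<dots> \<le> (e / (2 * A) * (A * cmod s)) / cmod s"
      proof (intro divide_right_mono norm_ge_zero)
        have "norm (f (\<lambda>k. s * v k) - f (\<lambda>_. 0) - D (\<lambda>k. s * v k)) \<le> e / (2 * A) * seq_norm X (\<lambda>k. s * v k)"
          using sv[of s] elim by (intro fd) auto
        also have "\<dots> \<le> e / (2 * A) * (A * cmod s)" using sv[of s] e A by (intro mult_left_mono) auto
        finally show "norm (f (\<lambda>k. s * v k) - f (\<lambda>_. 0) - D (\<lambda>k. s * v k)) \<le> e / (2 * A) * (A * cmod s)" .
      qed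
      also have "\<dots> = e / 2" using A elim(2) by simp
      finally show ?case using e by simp
    qed
  qed
qed

section \<open>A function in the ideal with slowly decaying derivative\<close>

text \<open>\<open>g\<close> is the linear functional \<open>L\<close> with coefficients
  \<open>c\<close>, minus its own values \<open>G z = L (alpha z)\<close> on the curve, read as a
  function of \<open>x 0\<close>. As \<open>alpha z 0 = z\<close>, the two cancel on the curve; on
  multiples of unit vectors of index at least 1, \<open>x 0 = 0\<close> and only \<open>L\<close> is
  seen.\<close>

lemma lacunary_function:
  fixes c :: "nat \<Rightarrow> real"
  assumes c: "summable c" "\<And>k. c k \<ge> 0"
  obtains U g where "seq_open X U" "(\<lambda>_. 0) \<in> U" "holomorphic_seq X U g"
    "\<And>z. alpha z \<in> U \<Longrightarrow> g (alpha z) = 0"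
    "\<And>n s. n \<ge> 1 \<Longrightarrow> g (\<lambda>k. s * unit_seq n k) = s * of_real (c n)"
proof -
  obtain G where G_ball: "\<forall>z\<in>ball 0 1. ((\<lambda>k. of_real (c k) * alpha z k) sums G z) \<and> G field_differentiable (at z)"
  proof (rule series_differentiable_comparison_complex[of "ball 0 1" "\<lambda>k z. of_real (c k) * alpha z k"])
    show "(\<lambda>z. of_real (c k) * alpha z k) field_differentiable at z" if "z \<in> ball 0 1" for k z
      unfolding alpha_def by (intro derivative_intros) (auto simp del: of_nat_Suc of_nat_add)
    show "\<exists>d h. 0 < d \<and> summable h \<and> range h \<subseteq> \<real>\<^sub>\<ge>\<^sub>0 \<and>
       (\<forall>\<^sub>F k in sequentially. \<forall>y\<in>ball z d \<inter> ball 0 1. cmod (of_real (c k) * alpha y k) \<le> cmod (h k))"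
      if "z \<in> ball 0 1" for z
    proof (rule exI[of _ 1], rule exI[of _ "\<lambda>k. of_real (c k)"], intro conjI always_eventually allI ballI)
      show "summable (\<lambda>k. complex_of_real (c k))" using c(1) by (simp add: summable_of_real)
      show "range (\<lambda>k. complex_of_real (c k)) \<subseteq> \<real>\<^sub>\<ge>\<^sub>0" using c(2) by auto
      fix k y assume "y \<in> ball z 1 \<inter> ball (0::complex) 1"
      then have "cmod (alpha y k) \<le> square_weight k" using norm_alpha_le[of y 0 k] by simp
      also have "\<dots> \<le> 1" by (simp add: square_weight_def)
      finally show "cmod (of_real (c k) * alpha y k) \<le> cmod (complex_of_real (c k))"
        using c(2)[of k] by (simp add: norm_mult mult_left_le)
    qed simp
  qed (rule open_ball, blast)
  note G = bspec[OF G_ball]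
  define L where "L = (\<lambda>x. \<Sum>k. of_real (c k) * x k :: complex)"
  define g where "g = (\<lambda>x. L x - G (x 0))"
  \<comment> \<open>Membership of \<open>alpha z\<close> forces \<open>cmod z < 1\<close>, the disc
    on which the series for \<open>G\<close> is controlled.\<close>
  define U where "U = {x \<in> seqs X. cmod (x 0) < 1}"
  have term_le: "cmod (of_real (c k) * x k) \<le> c k * seq_norm X x" if "x \<in> seqs X" for x k
    using coordinate_le_seq_norm[OF that, of k] c(2)[of k] by (simp add: norm_mult mult_left_mono)
  have sn: "summable (\<lambda>k. cmod (of_real (c k) * x k))" if "x \<in> seqs X" for x
    by (rule summable_comparison_test'[OF summable_mult2[OF c(1), of "seq_norm X x"], of 0])
      (use term_le[OF that] in simp)
  have sx: "summable (\<lambda>k. of_real (c k) * x k)" if "x \<in> seqs X" for x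
    using sn[OF that] by (rule summable_norm_cancel)
  have L_add: "L (\<lambda>k. x k + h k) = L x + L h" if "x \<in> seqs X" "h \<in> seqs X" for x h
    using suminf_add[OF sx[OF that(1)] sx[OF that(2)]] by (simp add: L_def algebra_simps)
  have L_scale: "L (\<lambda>k. a * h k) = a * L h" if "h \<in> seqs X" for a h
    using suminf_mult[OF sx[OF that], of a] by (simp add: L_def mult_ac)
  have L_le: "cmod (L h) \<le> suminf c * seq_norm X h" if "h \<in> seqs X" for h
  proof -
    have "cmod (L h) \<le> (\<Sum>k. cmod (of_real (c k) * h k))" unfolding L_def by (rule summable_norm[OF sn[OF that]])
    also have "\<dots> \<le> (\<Sum>k. c k * seq_norm X h)"
      by (rule suminf_le[OF term_le[OF that] sn[OF that] summable_mult2[OF c(1)]])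
    also have "\<dots> = suminf c * seq_norm X h" by (rule suminf_mult2[OF c(1), symmetric])
    finally show ?thesis .
  qed
  show thesis
  proof (rule that[of U g])
    show "seq_open X U" unfolding seq_open_def
    proof (intro conjI ballI)
      show "U \<subseteq> seqs X" by (auto simp: U_def)
      fix x assume x: "x \<in> U"
      have "y \<in> U" if y: "y \<in> seqs X" "seq_norm X (\<lambda>k. y k - x k) < 1 - cmod (x 0)" for y
      proof -
        have "cmod (y 0 - x 0) < 1 - cmod (x 0)"
          using coordinate_le_seq_norm[OF seqs_diff[of y x], of 0] x y by (simp add: U_def)
        then show ?thesis using norm_triangle_ineq2[of "y 0" "x 0"] y(1) by (simp add: U_def)
      qed
      then show "\<exists>e>0. \<forall>y\<in>seqs X. seq_norm X (\<lambda>k. y k - x k) < e \<longrightarrow> y \<in> U"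
        using x by (intro exI[of _ "1 - cmod (x 0)"]) (auto simp: U_def)
    qed
    show "(\<lambda>_. 0) \<in> U" using finite_support_in_seqs[of 0 "\<lambda>_. 0"] by (simp add: U_def)
    show "holomorphic_seq X U g" unfolding holomorphic_seq_def
    proof
      fix x assume x: "x \<in> U"
      then have xX: "x \<in> seqs X" by (simp add: U_def)
      obtain G' where G': "(G has_field_derivative G') (at (x 0))"
        using G[of "x 0"] x by (auto simp: U_def field_differentiable_def)
      define D where "D = (\<lambda>h. L h - G' * h 0)"
      have "cmod (D h) \<le> (suminf c + cmod G') * seq_norm X h" if h: "h \<in> seqs X" for h
      proof -
        have "cmod (D h) \<le> cmod (L h) + cmod G' * cmod (h 0)"
          using norm_triangle_ineq4[of "L h" "G' * h 0"] by (simp add: D_def norm_mult)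
        also have "\<dots> \<le> suminf c * seq_norm X h + cmod G' * seq_norm X h"
          using L_le[OF h] coordinate_le_seq_norm[OF h] by (intro add_mono mult_left_mono) auto
        finally show ?thesis by (simp add: algebra_simps)
      qed
      then have "\<exists>K. \<forall>h\<in>seqs X. cmod (D h) \<le> K * seq_norm X h" by blast
      moreover have "D (\<lambda>k. h k + h' k) = D h + D h'" if "h \<in> seqs X" "h' \<in> seqs X" for h h'
        using L_add[OF that] by (simp add: D_def algebra_simps)
      moreover have "D (\<lambda>k. a * h k) = a *\<^sub>C D h" if "h \<in> seqs X" for a h
        using L_scale[OF that] by (simp add: D_def scaleC_complex_def algebra_simps)
      ultimately have "bounded_clinear_seq X D" unfolding bounded_clinear_seq_def by blast
      moreover have "\<exists>d>0. \<forall>h\<in>seqs X. seq_norm X h < d \<longrightarrow>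
          norm (g (\<lambda>k. x k + h k) - g x - D h) \<le> e * seq_norm X h" if e: "e > 0" for e
      proof -
        obtain d where d: "d > 0" "\<And>y. cmod (y - x 0) < d \<Longrightarrow>
            cmod (G y - G (x 0) - G' * (y - x 0)) \<le> e * cmod (y - x 0)"
          using G' e unfolding has_field_derivative_def has_derivative_at_alt by blast
        have "norm (g (\<lambda>k. x k + h k) - g x - D h) \<le> e * seq_norm X h"
          if h: "h \<in> seqs X" "seq_norm X h < d" for h
        proof -
          have h0: "cmod (h 0) \<le> seq_norm X h" by (rule coordinate_le_seq_norm[OF h(1)])
          have "g (\<lambda>k. x k + h k) - g x - D h = - (G (x 0 + h 0) - G (x 0) - G' * h 0)"
            by (simp add: g_def D_def L_add[OF xX h(1)])
          then have "norm (g (\<lambda>k. x k + h k) - g x - D h) \<le> e * cmod (h 0)"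
            using d(2)[of "x 0 + h 0"] h0 h(2) by (simp only: norm_minus_cancel) simp
          also have "\<dots> \<le> e * seq_norm X h" using h0 e by (intro mult_left_mono) auto
          finally show ?thesis .
        qed
        then show ?thesis using d(1) by blast
      qed
      ultimately show "\<exists>D. has_frechet_derivative_seq X g D x"
        unfolding has_frechet_derivative_seq_def by blast
    qed
    show "g (alpha z) = 0" if "alpha z \<in> U" for z
    proof -
      have "alpha z 0 = z" by (simp add: alpha_def)
      then have "z \<in> ball 0 1" using that by (simp add: U_def)
      then have "L (alpha z) = G z" using G[of z] by (simp add: L_def sums_iff)
      then show ?thesis using \<open>alpha z 0 = z\<close> by (simp add: g_def)
    qed
    show "g (\<lambda>k. s * unit_seq n k) = s * of_real (c n)" if n: "n \<ge> 1" for n s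
    proof -
      have "(\<lambda>k. of_real (c k) * (s * unit_seq n k)) = (\<lambda>k. if k = n then of_real (c k) * s else 0)"
        by (auto simp: unit_seq_def)
      moreover have "(\<lambda>k. if k = n then of_real (c k) * s else 0) sums (of_real (c n) * s)"
        by (rule sums_single)
      ultimately have "L (\<lambda>k. s * unit_seq n k) = of_real (c n) * s" by (simp add: L_def sums_iff)
      moreover have "G 0 = 0"
      proof -
        have "alpha 0 = (\<lambda>_. 0)" by (auto simp: alpha_def)
        then show ?thesis using G[of 0] sums_unique2[OF _ sums_zero] by auto
      qed
      moreover have "unit_seq n 0 = 0" using n by (simp add: unit_seq_def)
      ultimately show ?thesis by (simp add: g_def)
    qed
  qed
qed

text \<open>The auxiliary weight needs an exponent strictly between 1 and 2: with 3/2 it is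
  summable, and the radii, decaying with exponent 2, are still negligible against it.\<close>

lemma square_box_bounded:
  fixes f :: "(nat \<Rightarrow> complex) \<Rightarrow> 'b::complex_normed_vector"
  assumes "holomorphic_seq X (seqs X) f"
  obtains M where "\<And>x. (\<And>k. cmod (x k) \<le> 2 * square_weight k) \<Longrightarrow> norm (f x) \<le> M"
proof (rule holomorphic_seq_bounded_on_compact_box[of "\<lambda>k. real (k + 1) powr (-3/2)" "\<lambda>k. 2 * square_weight k", OF _ _ _ assms])
  have "summable (\<lambda>k. real k powr (-3/2))" by (simp add: summable_real_powr_iff)
  then show "summable (\<lambda>k. real (k + 1) powr (-3/2))" by (subst summable_iff_shift)
  show "(\<lambda>k. 2 * square_weight k / real (k + 1) powr (- 3 / 2)) \<longlonglongrightarrow> 0"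
    unfolding square_weight_def by real_asymp
qed (use that in auto)

end

section \<open>Values of an analytic homomorphism on the zero set\<close>

lemma eq_near_of_germ_eq:
  assumes "germ X x f = germ X x g" "x \<in> seqs X"
  obtains U where "seq_open X U" "x \<in> U" "\<And>y. y \<in> U \<Longrightarrow> f y = g y"
  using germ_self[OF assms(2), of f] assms(1) unfolding germ_def by blast

text \<open>Constant germs suffice as test sections: the image of the constant \<open>v\<close> lies
  in the ideal and so vanishes at \<open>x\<close> itself. \<open>norm0\<close> makes the zero map a
  derivative of the constant.\<close>

lemma analytic_hom_vanishing:
  fixes \<phi> :: "(nat \<Rightarrow> complex) \<Rightarrow> ('f::complex_banach \<Rightarrow>\<^sub>L complex)"
  assumes \<phi>: "analytic_hom X (vanishing_stalk X A) \<phi>" and x: "x \<in> seqs X" "x \<in> A"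
    and norm0: "\<And>h. h \<in> seqs X \<Longrightarrow> 0 \<le> seq_norm X h"
  shows "\<phi> x = 0"
proof (rule blinfun_eqI)
  fix v :: 'f
  have "has_frechet_derivative_seq X (\<lambda>_. v) (\<lambda>_. 0) y" for y
    using norm0 unfolding has_frechet_derivative_seq_def bounded_clinear_seq_def
    by (auto intro: exI[of _ 1] exI[of _ 0] simp: norm_scaleC simp flip: norm_eq_zero)
  then have "germ X x (\<lambda>_. v) \<in> O_stalk X x"
    using seq_open_seqs[of X] x(1) unfolding O_stalk_def holomorphic_seq_def by blast
  then have "germ X x (\<lambda>y. blinfun_apply (\<phi> y) v) \<in> vanishing_stalk X A x"
    using \<phi> x(1) stalk_map_germ[OF x(1), of \<phi> "\<lambda>_. v"] unfolding analytic_hom_def by metis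
  then obtain g U where "germ X x (\<lambda>y. blinfun_apply (\<phi> y) v) = germ X x g" "x \<in> U" "\<forall>y\<in>U \<inter> A. g y = 0"
    unfolding vanishing_stalk_def by blast
  then show "blinfun_apply (\<phi> x) v = blinfun_apply 0 v"
    using x by (metis IntI blinfun.zero_left eq_near_of_germ_eq)
qed

section \<open>Contradiction between the two decay rates at the origin\<close>

theorem mainTheorem5:
  fixes X :: seq_space
    and J :: "(nat \<Rightarrow> complex) \<Rightarrow> ((nat \<Rightarrow> complex) \<Rightarrow> complex) set set"
    and \<phi> :: "(nat \<Rightarrow> complex) \<Rightarrow> ('f::complex_banach \<Rightarrow>\<^sub>L complex)"
  assumes "(\<exists>p\<ge>1. X = Lp p) \<or> X = C0"
    and "J = vanishing_stalk X (alpha ` cball 0 1)"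
    and "analytic_hom X J \<phi>"
  shows "\<not> stalk_map X \<phi> (\<lambda>_. 0) ` O_stalk X (\<lambda>_. 0) = J (\<lambda>_. 0)"
proof
  assume surj: "stalk_map X \<phi> (\<lambda>_. 0) ` O_stalk X (\<lambda>_. 0) = J (\<lambda>_. 0)"
  interpret classical_seq_space X by unfold_locales (rule assms(1))
  have zero: "(\<lambda>_. 0) \<in> seqs X" by (rule finite_support_in_seqs[of 0]) simp
  have hol: "holomorphic_seq X (seqs X) \<phi>" using assms(3) unfolding analytic_hom_def by blast
  have vanish: "\<phi> (alpha z) = 0" if "cmod z \<le> 1" for z
    using analytic_hom_vanishing[of X "alpha ` cball 0 1" \<phi> "alpha z"] assms(2,3) that
      alpha_in_seqs[OF that] seq_norm_nonneg by auto
  have "alpha 0 = (\<lambda>_. 0)" by (auto simp: alpha_def)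
  then have \<phi>0: "\<phi> (\<lambda>_. 0) = 0" using vanish[of 0] by simp
  \<comment> \<open>Any ratio strictly between 1/2 and 1 would do: below 1 the coefficients are
    summable, above 1/2 they exceed the decay permitted by
    \<open>derivative_coordinate_bound\<close>.\<close>
  define c :: "nat \<Rightarrow> real" where "c = (\<lambda>k. (3/4) ^ k)"
  have c: "summable c" "\<And>k. c k \<ge> 0" by (auto simp: c_def summable_geometric)
  obtain U g where g: "seq_open X U" "(\<lambda>_. 0) \<in> U" "holomorphic_seq X U g"
    "\<And>z. alpha z \<in> U \<Longrightarrow> g (alpha z) = 0"
    "\<And>n s. n \<ge> 1 \<Longrightarrow> g (\<lambda>k. s * unit_seq n k) = s * of_real (c n)"
    using lacunary_function[OF c] by blast
  have "germ X (\<lambda>_. 0) g \<in> J (\<lambda>_. 0)"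
    unfolding assms(2) vanishing_stalk_def using g(1-4) by blast
  then obtain f V where f: "seq_open X V" "(\<lambda>_. 0) \<in> V" "holomorphic_seq X V f"
    and "germ X (\<lambda>_. 0) g = stalk_map X \<phi> (\<lambda>_. 0) (germ X (\<lambda>_. 0) f)"
    unfolding surj[symmetric] O_stalk_def by blast
  then have "germ X (\<lambda>_. 0) (\<lambda>y. blinfun_apply (\<phi> y) (f y)) = germ X (\<lambda>_. 0) g"
    using stalk_map_germ[OF zero] by metis
  then obtain W where W: "seq_open X W" "(\<lambda>_. 0) \<in> W" "\<And>y. y \<in> W \<Longrightarrow> blinfun_apply (\<phi> y) (f y) = g y"
    using eq_near_of_germ_eq zero by blast
  obtain D where D: "has_frechet_derivative_seq X \<phi> D (\<lambda>_. 0)"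
    using hol zero unfolding holomorphic_seq_def by blast
  obtain Df where Df: "has_frechet_derivative_seq X f Df (\<lambda>_. 0)"
    using f unfolding holomorphic_seq_def by blast
  define v where "v = f (\<lambda>_. 0)"
  \<comment> \<open>Product rule in the direction \<open>unit_seq n\<close>: as
    \<open>\<phi>\<close> vanishes at 0, the derivative of \<open>f\<close> drops out and
    \<open>D (unit_seq n)\<close> applied to \<open>v\<close> remains. On the other side
    \<open>g\<close> is exactly linear along this direction with slope \<open>c n\<close>, since
    \<open>n \<ge> 1\<close>.\<close>
  have Dn: "blinfun_apply (D (unit_seq n)) v = of_real (c n)" if n: "n \<ge> 1" for n
  proof -
    obtain B where B: "B \<ge> 0" "\<And>k. cmod (unit_seq n k) \<le> B * square_weight k"
      by (rule finite_support_dominated[of "Suc n" "unit_seq n"]) (auto simp: unit_seq_def)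
    have "((\<lambda>s. blinfun_apply (inverse s *\<^sub>C (\<phi> (\<lambda>k. s * unit_seq n k) - \<phi> (\<lambda>_. 0)))
        (f (\<lambda>k. s * unit_seq n k))) \<longlongrightarrow> blinfun_apply (D (unit_seq n)) v) (at 0)"
      unfolding v_def
      by (intro blinfun.tendsto frechet_derivative_seq_directional[OF D B(2)]
          frechet_derivative_seq_directional(1)[OF Df B(2)])
    moreover have "eventually (\<lambda>s. blinfun_apply (inverse s *\<^sub>C (\<phi> (\<lambda>k. s * unit_seq n k) - \<phi> (\<lambda>_. 0)))
        (f (\<lambda>k. s * unit_seq n k)) = of_real (c n)) (at 0)"
    proof -
      obtain e where e: "e > 0" "\<And>y. y \<in> seqs X \<Longrightarrow> seq_norm X y < e \<Longrightarrow> y \<in> W"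
        using W(1,2) unfolding seq_open_def by fastforce
      obtain C where C: "C > 0"
        "\<And>h B. 0 \<le> B \<Longrightarrow> (\<And>k. cmod (h k) \<le> B * square_weight k) \<Longrightarrow>
          h \<in> seqs X \<and> seq_norm X h \<le> C * B"
        using square_dominated_seq by blast
      have "((\<lambda>s::complex. C * (cmod s * B)) \<longlongrightarrow> C * (cmod 0 * B)) (at 0)" by (intro tendsto_intros)
      then have "eventually (\<lambda>s::complex. C * (cmod s * B) < e) (at 0)"
        using e(1) by (intro order_tendstoD(2)[of _ 0]) auto
      moreover have "eventually (\<lambda>s::complex. s \<noteq> 0) (at 0)" by (simp add: eventually_at_filter)
      ultimately show ?thesis
      proof eventually_elim
        case (elim s)
        have "cmod (s * unit_seq n k) \<le> (cmod s * B) * square_weight k" for k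
          using mult_left_mono[OF B(2)[of k], of "cmod s"] by (simp add: norm_mult mult.assoc)
        from C(2)[OF _ this] have "(\<lambda>k. s * unit_seq n k) \<in> W"
          using elim(1) B(1) by (intro e(2)) auto
        from W(3)[OF this] show ?case
          using g(5)[OF n, of s] elim(2) by (simp add: \<phi>0 blinfun_apply_scaleC scaleC_complex_def)
      qed
    qed
    ultimately have "((\<lambda>s::complex. of_real (c n)) \<longlongrightarrow> blinfun_apply (D (unit_seq n)) v) (at 0)"
      by (rule Lim_transform_eventually)
    then show ?thesis using tendsto_unique[OF _ tendsto_const] by (metis at_neq_bot)
  qed
  \<comment> \<open>\<open>f\<close> is holomorphic only near 0, but freezing it at its value
    \<open>v\<close> makes \<open>u\<close> holomorphic on the whole space. This is what allows the
    truncated curve to be followed outside the unit disc; on the curve \<open>u\<close> vanishes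
    along with \<open>\<phi>\<close>.\<close>
  define u where "u = (\<lambda>x. blinfun_apply (\<phi> x) v)"
  have u: "holomorphic_seq X (seqs X) u"
    using hol has_frechet_derivative_seq_blinfun_apply[of X \<phi>] unfolding holomorphic_seq_def u_def by blast
  have Du: "has_frechet_derivative_seq X u (\<lambda>h. blinfun_apply (D h) v) (\<lambda>_. 0)"
    unfolding u_def by (rule has_frechet_derivative_seq_blinfun_apply[OF D])
  obtain M where M: "\<And>x. (\<And>k. cmod (x k) \<le> 2 * square_weight k) \<Longrightarrow> norm (u x) \<le> M"
    using square_box_bounded[OF u] by blast
  have le: "2 * (3/2) ^ n \<le> M * (real (n + 1))\<^sup>2" if "n \<ge> 1" for n :: nat
  proof -
    have "(3/4) ^ n * 2 ^ (n + 1) \<le> M * (real (n + 1))\<^sup>2"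
      using derivative_coordinate_bound[OF u _ Du M, of n] vanish Dn[OF that]
      by (simp add: u_def c_def norm_power)
    moreover have "(3/4) ^ n * 2 ^ (n + 1) = 2 * (3/2 :: real) ^ n"
      by (simp flip: power_mult_distrib)
    ultimately show ?thesis by simp
  qed
  have "(\<lambda>n. (real (n + 1))\<^sup>2 / (2 * (3/2) ^ n)) \<longlonglongrightarrow> 0" by real_asymp
  then have "(\<lambda>n. M * ((real (n + 1))\<^sup>2 / (2 * (3/2) ^ n))) \<longlonglongrightarrow> 0"
    by (rule tendsto_mult_right_zero)
  then have "eventually (\<lambda>n. M * ((real (n + 1))\<^sup>2 / (2 * (3/2) ^ n)) < 1) sequentially"
    by (rule order_tendstoD(2)) simp
  then have "eventually (\<lambda>n::nat. False) sequentially"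
    using eventually_ge_at_top[of "1::nat"]
  proof eventually_elim
    case (elim n)
    have "2 * (3/2) ^ n > (0::real)" by simp
    then show ?case using elim(1) le[OF elim(2)] by (simp add: divide_less_eq del: power_Suc)
  qed
  then show False by simp
qed

end
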